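(* Let $H_0$, $(L,D(L))$, $H_1$, $H_{-1}$, $(\lambda_k)_{k\ge1}$ and $\mathbb{H}$, $(A,D(A))$ be as described in the context, where $B:H_1\to H_{-1}$ is a bounded linear operator satisfying $\langle B\phi,\psi\rangle=\overline{\langle B\psi,\phi\rangle}$ and $\langle B\phi,\phi\rangle\ge0$ for all $\phi,\psi\in H_1$, and such that for all $k\ge1$ $$\frac1{\beta_k}:=\min\{\langle B\phi,\phi\rangle\;;\;\phi\in N(L-\lambda_kI),\ \|\phi\|=1\}>0.$$ Then there exists a constant $c_*>0$ such that for all $\omega\in\mathbb{R}$ one has $$\|R(\mathrm{i}\omega,A)\|\le c_*\,c(\omega),$$ where $$c(\omega):=\left(\frac{\beta_k\lambda_k}{|\omega|}+(1+\beta_k\lambda_k)\,(\alpha_{k-1}(\omega)+\alpha_{k+1}(\omega))^2\,(1+|\omega|)\right)c^*$$ for $k\ge 1$ such that $\lambda_{k-1}<\omega^2<\lambda_{k+1}$ (with $\lambda_0:=0$), $c^*:=16(1+\|B\|_{H_1\to H_{-1}})^2$ and $\alpha_j(\omega):=\dfrac{\lambda_j}{|\omega^2-\lambda_j|}$ for $\omega^2\neq\lambda_j$; for $\omega=0$, $c(0)$ is understood as $+\infty$.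
   Context: $H_0$ is an infinite dimensional, complex, separable Hilbert space with scalar product $(\cdot|\cdot)$ and norm $\|\cdot\|$. $(L,D(L))$ is a positive (in the sense of forms) self-adjoint, densely defined unbounded operator on $H_0$ with compact resolvent. Its distinct eigenvalues are $0<\lambda_1<\lambda_2<\cdots$, $\lambda_k\to+\infty$, each of finite multiplicity. $N(T)$ denotes the kernel of $T$. $H_1:=D(L^{1/2})$ with norm $\|L^{1/2}u\|$, and $H_{-1}:=(H_1)'$, $H_0$ being identified with its dual, so that $H_1\subset H_0\subset H_{-1}$ (equivalently, $H_{-1}$ is the completion of $H_0$ for the norm $\|L^{-1/2}f\|$). $\langle\cdot,\cdot\rangle$ is the duality between $H_{-1}$ and $H_1$, with $\langle f,\phi\rangle=(\phi|f)$ for $f\in H_0$, $\phi\in H_1$. $L$ extends to an isometric isomorphism from $H_1$ onto $H_{-1}$. $\mathbb{H}:=H_1\times H_0$ with norm $\|(u_0,u_1)\|_{\mathbb{H}}^2=\|L^{1/2}u_0\|^2+\|u_1\|^2$; $A(u_0,u_1):=(-u_1,\,Lu_0+Bu_1)$ with $D(A):=\{(u_0,u_1)\in\mathbb{H}\;;\;u_1\in H_1,\ Lu_0+Bu_1\in H_0\}$. $R(\lambda,A):=(A-\lambda I)^{-1}$ for $\lambda$ in the resolvent set $\rho(A)$ (under the stated hypotheses $\mathrm{i}\mathbb{R}\subset\rho(A)$), and $\|R(\lambda,A)\|$ is its operator norm on $\mathbb{H}$. When several integers $k$ satisfy $\lambda_{k-1}<\omega^2<\lambda_{k+1}$, $c(\omega)$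 may be taken with any of them. *)

theory Defs
  imports "HOL-Analysis.Analysis"
begin

subsection \<open>Complex inner product spaces\<close>

class scaleC =
  fixes scaleC :: "complex \<Rightarrow> 'a \<Rightarrow> 'a" (infixr "*\<^sub>C" 75)

class complex_vector = scaleC + real_vector +
  assumes scaleC_add_right: "a *\<^sub>C (x + y) = a *\<^sub>C x + a *\<^sub>C y"
    and scaleC_add_left: "(a + b) *\<^sub>C x = a *\<^sub>C x + b *\<^sub>C x"
    and scaleC_scaleC: "a *\<^sub>C b *\<^sub>C x = (a * b) *\<^sub>C x"
    and scaleC_of_real: "complex_of_real r *\<^sub>C x = r *\<^sub>R x"

global_interpretation complex_vector:
  vector_space "scaleC :: complex \<Rightarrow> 'a \<Rightarrow> 'a :: complex_vector"
  defines csubspace = complex_vector.subspace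
    and cspan = complex_vector.span
proof unfold_locales
  show "1 *\<^sub>C x = x" for x :: 'a
    using scaleC_of_real[of 1 x] by simp
qed (simp_all add: scaleC_add_right scaleC_add_left scaleC_scaleC)

instantiation prod :: (complex_vector, complex_vector) complex_vector
begin

definition scaleC_prod :: "complex \<Rightarrow> 'a \<times> 'b \<Rightarrow> 'a \<times> 'b" where
  "scaleC_prod c U = (c *\<^sub>C fst U, c *\<^sub>C snd U)"

instance
  by standard
    (simp_all add: scaleC_prod_def prod_eq_iff scaleC_add_right scaleC_add_left
      scaleC_scaleC scaleC_of_real)

end

text \<open>
  The scalar product is conjugate-linear in its first and linear in its second argument.
  Its real part is the real inner product, so norm, topology and completeness are those of
  the underlying real inner product space.
\<close>

class complex_inner = complex_vector + real_inner +
  fixes cinner :: "'a \<Rightarrow> 'a \<Rightarrow> complex"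
  assumes cinner_commute: "cinner x y = cnj (cinner y x)"
    and cinner_add_right: "cinner x (y + z) = cinner x y + cinner x z"
    and cinner_scaleC_right: "cinner x (c *\<^sub>C y) = c * cinner x y"
    and inner_eq_Re_cinner: "inner x y = Re (cinner x y)"


subsection \<open>Unbounded operators\<close>

text \<open>
  An unbounded operator is a partial map \<open>T\<close> with domain \<open>dom T\<close>; for \<open>u \<in> dom T\<close> its value
  is \<open>the (T u)\<close>. Map composition \<open>S \<circ>\<^sub>m T\<close> then has the usual maximal domain
  of a product of unbounded operators.
\<close>

definition linear_op :: "('a::complex_vector \<rightharpoonup> 'a) \<Rightarrow> bool" where
  "linear_op T \<longleftrightarrow> csubspace (dom T) \<and>
    (\<forall>x\<in>dom T. \<forall>y\<in>dom T. the (T (x + y)) = the (T x) + the (T y)) \<and>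
    (\<forall>c. \<forall>x\<in>dom T. the (T (c *\<^sub>C x)) = c *\<^sub>C the (T x))"

definition op_adjoint :: "('a::complex_inner \<rightharpoonup> 'a) \<Rightarrow> ('a \<rightharpoonup> 'a)" where
  "op_adjoint T v =
    (if \<exists>w. \<forall>u\<in>dom T. cinner (the (T u)) v = cinner u w
     then Some (THE w. \<forall>u\<in>dom T. cinner (the (T u)) v = cinner u w)
     else None)"

definition selfadjoint_op :: "('a::complex_inner \<rightharpoonup> 'a) \<Rightarrow> bool" where
  "selfadjoint_op T \<longleftrightarrow> linear_op T \<and> closure (dom T) = UNIV \<and> op_adjoint T = T"

definition positive_op :: "('a::complex_inner \<rightharpoonup> 'a) \<Rightarrow> bool" where
  "positive_op T \<longleftrightarrow> (\<forall>u\<in>dom T. cinner u (the (T u)) \<in> \<real>\<^sub>\<ge>\<^sub>0)"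

definition unbounded_op :: "('a::complex_inner \<rightharpoonup> 'a) \<Rightarrow> bool" where
  "unbounded_op T \<longleftrightarrow> \<not> (\<exists>K. \<forall>u\<in>dom T. norm (the (T u)) \<le> K * norm u)"

definition op_sqrt :: "('a::complex_inner \<rightharpoonup> 'a) \<Rightarrow> ('a \<rightharpoonup> 'a)" where
  "op_sqrt L = (THE S. selfadjoint_op S \<and> positive_op S \<and> S \<circ>\<^sub>m S = L)"

definition eigenspace :: "('a::complex_vector \<rightharpoonup> 'a) \<Rightarrow> complex \<Rightarrow> 'a set" where
  "eigenspace T z = {u \<in> dom T. the (T u) = z *\<^sub>C u}"

definition eigenvalues :: "('a::complex_vector \<rightharpoonup> 'a) \<Rightarrow> complex set" where
  "eigenvalues T = {z. \<exists>u\<in>eigenspace T z. u \<noteq> 0}"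

text \<open>
  Operators between normed spaces that need not be types: a space is given by a carrier
  \<open>X\<close> and a norm \<open>nX\<close>. The expression for \<open>opnorm\<close> is the one of \<^const>\<open>onorm\<close>,
  with quotients \<open>0/0 = 0\<close>; it is the operator norm only when \<open>bounded_on\<close> holds.
\<close>

definition bounded_on :: "'a set \<Rightarrow> ('a \<Rightarrow> real) \<Rightarrow> ('b \<Rightarrow> real) \<Rightarrow> ('a \<Rightarrow> 'b) \<Rightarrow> bool" where
  "bounded_on X nX nY f \<longleftrightarrow> (\<exists>K. \<forall>x\<in>X. nY (f x) \<le> K * nX x)"

definition opnorm :: "'a set \<Rightarrow> ('a \<Rightarrow> real) \<Rightarrow> ('b \<Rightarrow> real) \<Rightarrow> ('a \<Rightarrow> 'b) \<Rightarrow> real" where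
  "opnorm X nX nY f = (SUP x\<in>X. nY (f x) / nX x)"

definition resolvent :: "('a::complex_vector \<rightharpoonup> 'a) \<Rightarrow> complex \<Rightarrow> 'a \<Rightarrow> 'a" where
  "resolvent T z = inv_into (dom T) (\<lambda>u. the (T u) - z *\<^sub>C u)"

definition resolvent_set ::
  "'a::complex_vector set \<Rightarrow> ('a \<Rightarrow> real) \<Rightarrow> ('a \<rightharpoonup> 'a) \<Rightarrow> complex set" where
  "resolvent_set X nX T =
    {z. bij_betw (\<lambda>u. the (T u) - z *\<^sub>C u) (dom T) X \<and> bounded_on X nX nX (resolvent T z)}"

definition compact_resolvent :: "('a::complex_inner \<rightharpoonup> 'a) \<Rightarrow> bool" where
  "compact_resolvent T \<longleftrightarrow>
    (\<exists>z\<in>resolvent_set UNIV norm T. compact (closure (resolvent T z ` cball 0 1)))"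


subsection \<open>The spaces \<open>H\<^sub>1\<close> and \<open>H\<^sub>-\<^sub>1\<close>\<close>

definition H1 :: "('a::complex_inner \<rightharpoonup> 'a) \<Rightarrow> 'a set" where
  "H1 L = dom (op_sqrt L)"

definition norm_H1 :: "('a::complex_inner \<rightharpoonup> 'a) \<Rightarrow> 'a \<Rightarrow> real" where
  "norm_H1 L u = norm (the (op_sqrt L u))"

text \<open>
  An element \<open>f\<close> of the dual of \<open>H\<^sub>1\<close> is represented by the function \<open>\<phi> \<mapsto> \<langle>f,\<phi>\<rangle>\<close>, extended
  by \<open>0\<close> outside \<open>H\<^sub>1\<close>. For \<open>f\<close> in the Hilbert space, \<open>\<langle>f,\<phi>\<rangle> = (\<phi>|f)\<close>. As
  \<^const>\<open>cinner\<close> is conjugate-linear in its first argument, the functionals are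
  conjugate-linear; with the pointwise vector space structure, the embedding of the Hilbert
  space is then complex-linear.
\<close>

definition Hm1 :: "('a::complex_inner \<rightharpoonup> 'a) \<Rightarrow> ('a \<Rightarrow> complex) set" where
  "Hm1 L = {f. (\<forall>\<phi>. \<phi> \<notin> H1 L \<longrightarrow> f \<phi> = 0) \<and>
    (\<forall>\<phi>\<in>H1 L. \<forall>\<psi>\<in>H1 L. f (\<phi> + \<psi>) = f \<phi> + f \<psi>) \<and>
    (\<forall>c. \<forall>\<phi>\<in>H1 L. f (c *\<^sub>C \<phi>) = cnj c * f \<phi>) \<and>
    bounded_on (H1 L) (norm_H1 L) cmod f}"

definition norm_Hm1 :: "('a::complex_inner \<rightharpoonup> 'a) \<Rightarrow> ('a \<Rightarrow> complex) \<Rightarrow> real" where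
  "norm_Hm1 L f = opnorm (H1 L) (norm_H1 L) cmod f"

definition embed_Hm1 :: "('a::complex_inner \<rightharpoonup> 'a) \<Rightarrow> 'a \<Rightarrow> ('a \<Rightarrow> complex)" where
  "embed_Hm1 L f = (\<lambda>\<phi>. if \<phi> \<in> H1 L then cinner \<phi> f else 0)"

text \<open>The extension of \<open>L\<close> to an operator from \<open>H\<^sub>1\<close> to its dual.\<close>

definition L_ext :: "('a::complex_inner \<rightharpoonup> 'a) \<Rightarrow> 'a \<Rightarrow> ('a \<Rightarrow> complex)" where
  "L_ext L u =
    (\<lambda>\<phi>. if \<phi> \<in> H1 L then cinner (the (op_sqrt L \<phi>)) (the (op_sqrt L u)) else 0)"

lemma L_ext_extends:
  assumes S: "selfadjoint_op (op_sqrt L)" "op_sqrt L \<circ>\<^sub>m op_sqrt L = L"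
    and u: "u \<in> dom L"
  shows "u \<in> H1 L" and "L_ext L u = embed_Hm1 L (the (L u))"
proof -
  define S where "S = op_sqrt L"
  have dense: "closure (dom S) = UNIV" and adj: "op_adjoint S = S" and SS: "S \<circ>\<^sub>m S = L"
    using S by (auto simp: S_def selfadjoint_op_def)
  obtain v w where v: "S u = Some v" and w: "S v = Some w"
    using u SS by (auto simp: map_comp_def split: option.splits)
  have Lu: "L u = Some w"
    using v w SS by (auto simp: map_comp_def)
  show "u \<in> H1 L"
    unfolding H1_def S_def[symmetric] using v by blast
  let ?P = "\<lambda>z. \<forall>x\<in>dom S. cinner (the (S x)) v = cinner x z"
  have *: "(if \<exists>z. ?P z then Some (THE z. ?P z) else None) = Some w"
    using w unfolding adj[symmetric, THEN fun_cong, of v] op_adjoint_def .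
  have ex: "\<exists>z. ?P z"
    by (rule ccontr) (use * in \<open>simp only: if_False option.distinct\<close>)
  have wthe: "(THE z. ?P z) = w"
    using * unfolding if_P[OF ex] by (rule option.inject[THEN iffD1])
  have uniq: "z = z'" if z: "?P z" "?P z'" for z z'
  proof -
    have "inner x (z - z') = 0" if "x \<in> dom S" for x
    proof -
      have "cinner x z = cinner x z'"
        using z that by simp
      then have "inner x z = inner x z'"
        by (simp only: inner_eq_Re_cinner)
      then show ?thesis
        by (simp add: inner_diff_right)
    qed
    then have "dom S \<subseteq> {x. inner x (z - z') = 0}"
      by auto
    moreover have "closed {x. inner x (z - z') = 0}"
      by (intro closed_Collect_eq continuous_intros)
    ultimately have "closure (dom S) \<subseteq> {x. inner x (z - z') = 0}"
      by (rule closure_minimal)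
    moreover have "z - z' \<in> closure (dom S)"
      unfolding dense by (rule UNIV_I)
    ultimately have "inner (z - z') (z - z') = 0"
      by blast
    then show ?thesis by simp
  qed
  obtain z where z: "?P z"
    using ex by blast
  have "(THE z. ?P z) = z"
    by (rule the_equality, rule z) (rule uniq[OF _ z])
  then have "z = w"
    using wthe by (rule trans[OF sym])
  then have "?P w"
    using z by blast
  then show "L_ext L u = embed_Hm1 L (the (L u))"
    unfolding L_ext_def embed_Hm1_def H1_def S_def[symmetric] v Lu option.sel
    by (intro ext) simp
qed

definition linear_H1_Hm1 :: "('a::complex_inner \<rightharpoonup> 'a) \<Rightarrow> ('a \<Rightarrow> 'a \<Rightarrow> complex) \<Rightarrow> bool" where
  "linear_H1_Hm1 L B \<longleftrightarrow> (\<forall>\<phi>\<in>H1 L. B \<phi> \<in> Hm1 L) \<and>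
    (\<forall>\<phi>\<in>H1 L. \<forall>\<psi>\<in>H1 L. B (\<phi> + \<psi>) = (\<lambda>\<eta>. B \<phi> \<eta> + B \<psi> \<eta>)) \<and>
    (\<forall>c. \<forall>\<phi>\<in>H1 L. B (c *\<^sub>C \<phi>) = (\<lambda>\<eta>. c * B \<phi> \<eta>))"


subsection \<open>The damped wave operator\<close>

definition wave_space :: "('a::complex_inner \<rightharpoonup> 'a) \<Rightarrow> ('a \<times> 'a) set" where
  "wave_space L = H1 L \<times> UNIV"

definition norm_wave :: "('a::complex_inner \<rightharpoonup> 'a) \<Rightarrow> 'a \<times> 'a \<Rightarrow> real" where
  "norm_wave L U = sqrt ((norm_H1 L (fst U))\<^sup>2 + (norm (snd U))\<^sup>2)"

definition wave_op ::
  "('a::complex_inner \<rightharpoonup> 'a) \<Rightarrow> ('a \<Rightarrow> 'a \<Rightarrow> complex) \<Rightarrow> ('a \<times> 'a \<rightharpoonup> 'a \<times> 'a)" where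
  "wave_op L B = (\<lambda>(u0, u1).
    if u0 \<in> H1 L \<and> u1 \<in> H1 L \<and>
      (\<exists>f. (\<lambda>\<phi>. L_ext L u0 \<phi> + B u1 \<phi>) = embed_Hm1 L f)
    then Some (- u1, THE f. (\<lambda>\<phi>. L_ext L u0 \<phi> + B u1 \<phi>) = embed_Hm1 L f)
    else None)"

abbreviation rho_wave ::
  "('a::complex_inner \<rightharpoonup> 'a) \<Rightarrow> ('a \<Rightarrow> 'a \<Rightarrow> complex) \<Rightarrow> complex set" where
  "rho_wave L B \<equiv> resolvent_set (wave_space L) (norm_wave L) (wave_op L B)"

abbreviation norm_resolvent_wave ::
  "('a::complex_inner \<rightharpoonup> 'a) \<Rightarrow> ('a \<Rightarrow> 'a \<Rightarrow> complex) \<Rightarrow> complex \<Rightarrow> real" where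
  "norm_resolvent_wave L B z \<equiv>
    opnorm (wave_space L) (norm_wave L) (norm_wave L) (resolvent (wave_op L B) z)"

definition alpha :: "(nat \<Rightarrow> real) \<Rightarrow> nat \<Rightarrow> real \<Rightarrow> real" where
  "alpha lam j \<omega> = lam j / \<bar>\<omega>\<^sup>2 - lam j\<bar>"

text \<open>\<open>b\<close> stands for the norm of \<open>B\<close> from \<open>H\<^sub>1\<close> to its dual.\<close>

definition c_bound :: "(nat \<Rightarrow> real) \<Rightarrow> (nat \<Rightarrow> real) \<Rightarrow> real \<Rightarrow> nat \<Rightarrow> real \<Rightarrow> real" where
  "c_bound lam \<beta> b k \<omega> =
    (\<beta> k * lam k / \<bar>\<omega>\<bar> +
      (1 + \<beta> k * lam k) * (alpha lam (k - 1) \<omega> + alpha lam (k + 1) \<omega>)\<^sup>2 * (1 + \<bar>\<omega>\<bar>)) *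
    (16 * (1 + b)\<^sup>2)"

end

theory Submission
  imports Defs
begin

text \<open>
  Everything is transported to \<open>H\<^sub>0\<close> by \<open>G = L\<^sup>-\<^sup>1\<^sup>/\<^sup>2\<close>, which maps \<open>H\<^sub>0\<close> isometrically onto \<open>H\<^sub>1\<close>.
  The damping \<open>B\<close> becomes a bounded nonnegative operator \<open>D\<close> with \<open>\<langle>B G x, G y\<rangle> = (y|D x)\<close>, and the
  stationary operator \<open>L - \<i> \<omega> B - \<omega>\<^sup>2\<close> becomes \<open>T \<omega> = 1 - \<i> \<omega> D - \<omega>\<^sup>2 G\<^sup>2\<close>.

  The heart of the proof is a lower bound for \<open>T \<omega>\<close> when \<open>\<lambda>\<^sub>k\<^sub>-\<^sub>1 < \<omega>\<^sup>2 < \<lambda>\<^sub>k\<^sub>+\<^sub>1\<close> (\<open>T_bounded_below\<close>).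
  The imaginary part of \<open>(x|T \<omega> x)\<close> bounds the damping \<open>(x|D x)\<close> by \<open>\<parallel>T \<omega> x\<parallel> \<parallel>x\<parallel> / |\<omega>|\<close>. The
  eigencomponents of \<open>x\<close> other than the \<open>k\<close>-th are nonresonant; testing with these components,
  with signs chosen so that the undamped part is coercive, bounds them in terms of
  \<open>\<alpha>\<^sub>k\<^sub>-\<^sub>1 + \<alpha>\<^sub>k\<^sub>+\<^sub>1\<close> and the damping of \<open>x\<close>. The \<open>k\<close>-th component is bounded by its own damping, with
  constant \<open>\<beta>\<^sub>k \<lambda>\<^sub>k\<close>, which is at most twice the sum of the damping of \<open>x\<close> and that of the other
  components. This gives \<open>\<parallel>x\<parallel> \<le> c(\<omega>) \<parallel>T \<omega> x\<parallel>\<close>. As the adjoint of \<open>T \<omega>\<close> is \<open>T (-\<omega>)\<close>, for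
  which the same bound holds, \<open>T \<omega>\<close> is invertible.

  The resolvent equation \<open>(A - \<i> \<omega>) (G x, G y) = (G a, g)\<close> means \<open>y = - a - \<i> \<omega> x\<close> and
  \<open>T \<omega> x = G g + D a - \<i> \<omega> G\<^sup>2 a\<close>. Splitting \<open>x\<close> according to the data \<open>g\<close> and \<open>a\<close> yields
  \<open>\<parallel>R(\<i> \<omega>, A)\<parallel> \<le> c\<^sub>* c(\<omega>)\<close> without a further power of \<open>\<omega>\<close> (\<open>resolvent_estimate\<close>). At
  \<open>\<omega> = 0\<close> the operator \<open>T \<omega>\<close> is the identity.

  The existence of \<open>G\<close>, of the eigencomponents and of \<open>L\<^sup>1\<^sup>/\<^sup>2\<close>, the unique positive square root of \<open>L\<close>,
  rests on the spectral theorem for \<open>L\<close>: a compact positive operator has an eigenvector in each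
  closed invariant subspace on which it does not vanish (\<open>compact_positive_eigenvector\<close>), and
  applying this to \<open>(L + 1)\<^sup>-\<^sup>1\<close> shows that the eigenvectors of \<open>L\<close> are total (\<open>eigenvectors_total\<close>).
\<close>


section \<open>Complex inner products\<close>

lemma cinner_zero_right [simp]: "cinner x (0::'a::complex_inner) = 0"
  using cinner_scaleC_right[of x 0 0] by simp

lemma cinner_zero_left [simp]: "cinner (0::'a::complex_inner) x = 0"
  using cinner_commute[of 0 x] by simp

lemma cinner_add_left: "cinner (x + y) z = cinner x z + cinner y (z::'a::complex_inner)"
  by (metis cinner_add_right cinner_commute complex_cnj_add)

lemma cinner_scaleC_left: "cinner (c *\<^sub>C x) y = cnj c * cinner x (y::'a::complex_inner)"
  by (metis cinner_commute cinner_scaleC_right complex_cnj_mult)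

lemma cinner_minus_right [simp]: "cinner x (- y) = - cinner x (y::'a::complex_inner)"
  using cinner_add_right[of x "- y" y] by (simp add: eq_neg_iff_add_eq_0)

lemma cinner_minus_left [simp]: "cinner (- x) y = - cinner x (y::'a::complex_inner)"
  using cinner_add_left[of "- x" x y] by (simp add: eq_neg_iff_add_eq_0)

lemma cinner_diff_right: "cinner x (y - z) = cinner x y - cinner x (z::'a::complex_inner)"
  using cinner_add_right[of x y "- z"] by simp

lemma cinner_diff_left: "cinner (x - y) z = cinner x z - cinner y (z::'a::complex_inner)"
  using cinner_add_left[of x "- y" z] by simp

lemma cinner_scaleR_right: "cinner x (r *\<^sub>R y) = of_real r * cinner x (y::'a::complex_inner)"
  by (metis cinner_scaleC_right scaleC_of_real)

lemma cinner_scaleR_left: "cinner (r *\<^sub>R x) y = of_real r * cinner x (y::'a::complex_inner)"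
  by (metis cinner_scaleC_left scaleC_of_real complex_cnj_complex_of_real)

lemmas cinner_linear =
  cinner_add_left cinner_add_right cinner_diff_left cinner_diff_right
  cinner_scaleC_left cinner_scaleC_right cinner_scaleR_left cinner_scaleR_right

lemma cinner_self: "cinner x x = of_real ((norm (x::'a::complex_inner))\<^sup>2)"
proof -
  have "Im (cinner x x) = 0"
    using cinner_commute[of x x] by (metis Im_complex_of_real cnj.simps(2) complex_cnj_complex_of_real neg_equal_zero)
  moreover have "Re (cinner x x) = (norm x)\<^sup>2"
    by (simp add: power2_norm_eq_inner inner_eq_Re_cinner)
  ultimately show ?thesis
    by (simp add: complex_eq_iff)
qed

lemma norm_scaleC [simp]: "norm (c *\<^sub>C x) = cmod c * norm (x::'a::complex_inner)"
proof -
  have "complex_of_real ((norm (c *\<^sub>C x))\<^sup>2) = of_real ((cmod c * norm x)\<^sup>2)"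
    unfolding cinner_self[symmetric] cinner_linear
    by (simp add: cinner_self power_mult_distrib complex_norm_square del: of_real_power)
  then have "(norm (c *\<^sub>C x))\<^sup>2 = (cmod c * norm x)\<^sup>2"
    by (simp only: of_real_eq_iff)
  then show ?thesis
    by (simp add: power2_eq_iff_nonneg)
qed

text \<open>Rotating \<open>y\<close> by a unit scalar makes the scalar product real and reduces the claim to the
  real inequality.\<close>

lemma cmod_cinner_le: "cmod (cinner x y) \<le> norm x * norm (y::'a::complex_inner)"
proof (cases "cinner x y = 0")
  case False
  define c where "c = cnj (cinner x y) / cmod (cinner x y)"
  have "cmod c = 1"
    using False by (simp add: c_def norm_divide)
  have "c * cinner x y = of_real (cmod (cinner x y))"
    using False by (simp add: c_def complex_norm_square[symmetric] power2_eq_square mult.commute)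
  then have "cmod (cinner x y) = inner x (c *\<^sub>C y)"
    by (simp add: inner_eq_Re_cinner cinner_linear)
  also have "\<dots> \<le> norm x * norm (c *\<^sub>C y)"
    by (rule norm_cauchy_schwarz)
  finally show ?thesis
    using \<open>cmod c = 1\<close> by simp
qed simp

lemma bounded_bilinear_cinner: "bounded_bilinear (cinner :: 'a::complex_inner \<Rightarrow> _)"
proof
  show "\<exists>K. \<forall>a b. norm (cinner (a::'a) b) \<le> norm a * norm b * K"
    by (rule exI[of _ 1]) (simp add: cmod_cinner_le)
qed (simp_all add: cinner_linear scaleR_conv_of_real)

lemma bounded_linear_scaleC: "bounded_linear (\<lambda>x::'a::complex_inner. c *\<^sub>C x)"
proof
  show "\<exists>K. \<forall>x::'a. norm (c *\<^sub>C x) \<le> norm x * K"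
    by (rule exI[of _ "cmod c"]) simp
  show "c *\<^sub>C (r *\<^sub>R x) = r *\<^sub>R c *\<^sub>C x" for r and x :: 'a
    by (metis scaleC_of_real scaleC_scaleC mult.commute)
qed (simp add: scaleC_add_right)

lemmas tendsto_cinner = bounded_bilinear.tendsto[OF bounded_bilinear_cinner]
lemmas tendsto_scaleC = bounded_linear.tendsto[OF bounded_linear_scaleC]

lemma cinner_eqI:
  assumes "\<And>z. cinner z x = cinner z (y::'a::complex_inner)"
  shows "x = y"
proof -
  have "cinner (x - y) (x - y) = 0"
    using assms[of "x - y"] by (simp add: cinner_diff_right)
  then show ?thesis
    by (simp add: cinner_self)
qed

text \<open>A complex scalar product is determined by its real part, since multiplying the first
  argument by \<open>\<i>\<close> exchanges real and imaginary parts.\<close>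

lemma cinner_eq_of_inner_eq:
  fixes x :: "'a::complex_inner" and f :: "'a \<Rightarrow> complex"
  assumes "\<And>z. inner z x = Re (f z)" and "f (\<i> *\<^sub>C y) = cnj \<i> * f y"
  shows "cinner y x = f y"
proof -
  have "Re (cnj \<i> * cinner y x) = Re (cnj \<i> * f y)"
    using assms(1)[of "\<i> *\<^sub>C y"] by (simp add: inner_eq_Re_cinner cinner_linear assms(2))
  moreover have "Re (cinner y x) = Re (f y)"
    using assms(1)[of y] by (simp add: inner_eq_Re_cinner)
  ultimately show ?thesis
    by (simp add: complex_eq_iff)
qed

lemma subspace_if_csubspace: "csubspace V \<Longrightarrow> subspace V"
  by (auto simp: subspace_def complex_vector.subspace_def simp flip: scaleC_of_real)

section \<open>Orthogonal projection and Riesz representation\<close>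

text \<open>A minimising sequence for the distance to a subspace is Cauchy by the
  parallelogram law, and the minimiser is the foot of the perpendicular.\<close>

theorem orthogonal_projection_exists:
  fixes V :: "'a::{real_inner, complete_space} set"
  assumes V: "subspace V" "closed V"
  shows "\<exists>p\<in>V. \<forall>v\<in>V. inner v (x - p) = 0"
proof -
  define D where "D = (INF v\<in>V. (norm (x - v))\<^sup>2)"
  have ne: "V \<noteq> {}"
    using V(1) subspace_0 by blast
  have bdd: "bdd_below ((\<lambda>v. (norm (x - v))\<^sup>2) ` V)"
    by (auto intro!: bdd_belowI[of _ 0])
  have D_le: "D \<le> (norm (x - v))\<^sup>2" if "v \<in> V" for v
    unfolding D_def by (rule cINF_lower[OF bdd that])
  have "\<exists>v\<in>V. (norm (x - v))\<^sup>2 < D + 1 / real (Suc n)" for n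
    using cINF_less_iff[OF ne bdd, of "D + 1 / real (Suc n)"] by (simp add: D_def)
  then obtain p where p: "\<And>n. p n \<in> V" "\<And>n. (norm (x - p n))\<^sup>2 < D + 1 / real (Suc n)"
    by metis
  have close: "(norm (p m - p n))\<^sup>2 \<le> 2 * (1 / real (Suc m)) + 2 * (1 / real (Suc n))" for m n
  proof -
    have "(1/2) *\<^sub>R (p m + p n) \<in> V"
      using p(1) V(1) by (simp add: subspace_add subspace_scale)
    then have "D \<le> (norm (x - (1/2) *\<^sub>R (p m + p n)))\<^sup>2"
      by (rule D_le)
    moreover have "(norm (p m - p n))\<^sup>2 + 4 * (norm (x - (1/2) *\<^sub>R (p m + p n)))\<^sup>2
        = 2 * (norm (x - p m))\<^sup>2 + 2 * (norm (x - p n))\<^sup>2"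
      by (simp add: power2_norm_eq_inner inner_diff_left inner_diff_right inner_add_left
          inner_add_right inner_commute algebra_simps)
    ultimately show ?thesis
      using p(2)[of m] p(2)[of n] by linarith
  qed
  have "Cauchy p"
  proof (rule metric_CauchyI)
    fix e :: real assume e: "e > 0"
    then obtain N :: nat where N: "4 / e\<^sup>2 < real N"
      using reals_Archimedean2 by blast
    have "dist (p m) (p n) < e" if mn: "N \<le> m" "N \<le> n" for m n
    proof -
      have small: "2 * (1 / real (Suc i)) < e\<^sup>2 / 2" if "N \<le> i" for i
      proof -
        have "4 / e\<^sup>2 < real (Suc i)"
          using N that by linarith
        then show ?thesis
          using e by (simp add: pos_divide_less_eq pos_less_divide_eq mult.commute)
      qed
      have "(norm (p m - p n))\<^sup>2 < e\<^sup>2"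
        using close[of m n] small[OF mn(1)] small[OF mn(2)] by linarith
      then show ?thesis
        using e by (simp add: dist_norm power2_less_imp_less)
    qed
    then show "\<exists>N. \<forall>m\<ge>N. \<forall>n\<ge>N. dist (p m) (p n) < e"
      by blast
  qed
  then obtain q where q: "p \<longlonglongrightarrow> q"
    using Cauchy_convergent convergent_def by blast
  have "q \<in> V"
    using closed_sequentially[OF V(2)] p(1) q by blast
  have "(\<lambda>n. (norm (x - p n))\<^sup>2) \<longlonglongrightarrow> (norm (x - q))\<^sup>2"
    by (intro tendsto_intros q)
  moreover have "(\<lambda>n. D + 1 / real (Suc n)) \<longlonglongrightarrow> D + 0"
    by (intro tendsto_intros LIMSEQ_Suc lim_1_over_n)
  ultimately have q_le: "(norm (x - q))\<^sup>2 \<le> D"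
    unfolding add_0_right
    by (rule LIMSEQ_le) (use p(2) in \<open>auto intro: less_imp_le\<close>)
  have "inner v (x - q) = 0" if v: "v \<in> V" for v
  proof (cases "v = 0")
    case False
    define t where "t = inner v (x - q) / (norm v)\<^sup>2"
    have "q + t *\<^sub>R v \<in> V"
      using \<open>q \<in> V\<close> v V(1) by (simp add: subspace_add subspace_scale)
    then have "(norm (x - q))\<^sup>2 \<le> (norm (x - (q + t *\<^sub>R v)))\<^sup>2"
      using q_le D_le by (meson order_trans)
    also have "\<dots> = (norm (x - q))\<^sup>2 - 2 * t * inner v (x - q) + t\<^sup>2 * (norm v)\<^sup>2"
      unfolding power2_norm_eq_inner
      by (simp add: inner_diff_left inner_diff_right inner_add_left
          inner_add_right inner_commute algebra_simps power2_eq_square)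
    also have "\<dots> = (norm (x - q))\<^sup>2 - (inner v (x - q))\<^sup>2 / (norm v)\<^sup>2"
      using False by (simp add: t_def power2_eq_square field_simps)
    finally have "(inner v (x - q))\<^sup>2 / (norm v)\<^sup>2 \<le> 0"
      by simp
    then show ?thesis
      using False by (simp add: divide_le_0_iff)
  qed simp
  with \<open>q \<in> V\<close> show ?thesis
    by blast
qed

lemma subspace_closure:
  assumes "subspace (V :: 'a::real_normed_vector set)"
  shows "subspace (closure V)"
proof (rule subspaceI)
  show "0 \<in> closure V"
    using assms closure_subset subspace_0 by blast
next
  fix x y assume "x \<in> closure V" "y \<in> closure V"
  then obtain f g where "\<And>n. f n \<in> V" "f \<longlonglongrightarrow> x" "\<And>n. g n \<in> V" "g \<longlonglongrightarrow> y"
    by (auto simp: closure_sequential)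
  then show "x + y \<in> closure V"
    using assms unfolding closure_sequential
    by (intro exI[of _ "\<lambda>n. f n + g n"]) (auto intro: tendsto_add subspace_add)
next
  fix c x assume "x \<in> closure V"
  then obtain f where "\<And>n. f n \<in> V" "f \<longlonglongrightarrow> x"
    by (auto simp: closure_sequential)
  then show "c *\<^sub>R x \<in> closure V"
    using assms unfolding closure_sequential
    by (intro exI[of _ "\<lambda>n. c *\<^sub>R f n"]) (auto intro: tendsto_scaleR subspace_scale)
qed

corollary dense_subspaceI:
  fixes V :: "'a::{real_inner, complete_space} set"
  assumes V: "subspace V" and perp: "\<And>w. (\<And>v. v \<in> V \<Longrightarrow> inner v w = 0) \<Longrightarrow> w = 0"
  shows "closure V = UNIV"
proof -
  have "x \<in> closure V" for x
  proof -
    obtain p where p: "p \<in> closure V" "\<forall>v\<in>closure V. inner v (x - p) = 0"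
      using orthogonal_projection_exists[of "closure V" x] V by (auto simp: subspace_closure)
    have "x - p = 0"
      using p(2) closure_subset by (intro perp) blast
    then show ?thesis
      using p(1) by simp
  qed
  then show ?thesis
    by blast
qed

text \<open>The representing vector is a multiple of a vector orthogonal to the kernel.\<close>

theorem riesz_representation:
  fixes f :: "'a::{real_inner, complete_space} \<Rightarrow> real"
  assumes f: "bounded_linear f"
  shows "\<exists>w. \<forall>x. f x = inner x w"
proof (cases "\<forall>x. f x = 0")
  case False
  interpret f: bounded_linear f by (rule f)
  obtain x where x: "f x \<noteq> 0"
    using False by blast
  define V where "V = {x. f x = 0}"
  have "subspace V"
    by (auto simp: V_def subspace_def f.add f.scaleR f.zero)
  moreover have "closed V"
    unfolding V_def by (intro closed_Collect_eq continuous_intros f.continuous_on)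
  ultimately obtain p where p: "p \<in> V" "\<And>v. v \<in> V \<Longrightarrow> inner v (x - p) = 0"
    using orthogonal_projection_exists[of V x] by blast
  define n where "n = x - p"
  have fn: "f n \<noteq> 0"
    using x p(1) by (simp add: n_def V_def f.diff)
  then have "n \<noteq> 0"
    using f.zero by auto
  have "f y = inner y ((f n / (norm n)\<^sup>2) *\<^sub>R n)" for y
  proof -
    have "y - (f y / f n) *\<^sub>R n \<in> V"
      using fn by (simp add: V_def f.diff f.scaleR)
    then have "inner (y - (f y / f n) *\<^sub>R n) n = 0"
      using p(2) by (simp add: n_def)
    then have "inner y n = f y / f n * (norm n)\<^sup>2"
      by (simp add: inner_diff_left power2_norm_eq_inner)
    then show ?thesis
      using fn \<open>n \<noteq> 0\<close> by simp
  qed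
  then show ?thesis
    by blast
qed (auto intro!: exI[of _ 0])


section \<open>Orthogonal decompositions and diagonal operators\<close>

lemma cinner_sums_right:
  "f sums s \<Longrightarrow> (\<lambda>n. cinner x (f n)) sums cinner x (s::'a::complex_inner)"
  by (rule bounded_linear.sums[OF
        bounded_bilinear.bounded_linear_right[OF bounded_bilinear_cinner]])

locale orthogonal_decomposition =
  fixes E :: "nat \<Rightarrow> 'h::{complex_inner, complete_space} set"
  assumes csubspace_E: "csubspace (E j)"
    and closed_E: "closed (E j)"
    and orthogonal: "i \<noteq> j \<Longrightarrow> x \<in> E i \<Longrightarrow> y \<in> E j \<Longrightarrow> cinner x y = 0"
    and total: "(\<And>j e. e \<in> E j \<Longrightarrow> cinner e w = 0) \<Longrightarrow> w = 0"
begin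

definition proj :: "nat \<Rightarrow> 'h \<Rightarrow> 'h" where
  "proj j x = (SOME p. p \<in> E j \<and> (\<forall>e\<in>E j. cinner e (x - p) = 0))"

text \<open>The real orthogonal projection is also orthogonal for the complex product, because a
  complex subspace is closed under multiplication by \<open>\<i>\<close>.\<close>

lemma proj_perp: "proj j x \<in> E j \<and> (\<forall>e\<in>E j. cinner e (x - proj j x) = 0)"
  unfolding proj_def
proof (rule someI_ex)
  obtain p where p: "p \<in> E j" "\<And>e. e \<in> E j \<Longrightarrow> inner e (x - p) = 0"
    using orthogonal_projection_exists[of "E j" x] csubspace_E closed_E subspace_if_csubspace
    by blast
  have "cinner e (x - p) = 0" if e: "e \<in> E j" for e
  proof -
    have "Re (cinner e (x - p)) = 0" "Re (cinner (\<i> *\<^sub>C e) (x - p)) = 0"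
      using p(2)[OF e] p(2)[of "\<i> *\<^sub>C e"] e csubspace_E[of j] complex_vector.subspace_scale
      unfolding inner_eq_Re_cinner by blast+
    then show ?thesis
      unfolding cinner_scaleC_left by (simp add: complex_eq_iff)
  qed
  then show "\<exists>p. p \<in> E j \<and> (\<forall>e\<in>E j. cinner e (x - p) = 0)"
    using p(1) by blast
qed

lemma proj_in [simp]: "proj j x \<in> E j"
  using proj_perp by blast

lemma cinner_proj_right: "e \<in> E j \<Longrightarrow> cinner e (proj j x) = cinner e x"
  using proj_perp[of j x] by (simp add: cinner_diff_right)

lemma proj_eqI:
  assumes p: "p \<in> E j" and "\<And>e. e \<in> E j \<Longrightarrow> cinner e p = cinner e x"
  shows "proj j x = p"
proof -
  have "proj j x - p \<in> E j"
    using p csubspace_E complex_vector.subspace_diff proj_in by blast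
  then have "cinner (proj j x - p) (proj j x - p) = 0"
    using assms(2) by (simp add: cinner_diff_right cinner_proj_right)
  then show ?thesis
    by (simp add: cinner_self)
qed

lemma proj_add: "proj j (x + y) = proj j x + proj j y"
  by (intro proj_eqI complex_vector.subspace_add[OF csubspace_E]) (auto simp: cinner_linear cinner_proj_right)

lemma proj_diff: "proj j (x - y) = proj j x - proj j y"
  by (intro proj_eqI complex_vector.subspace_diff[OF csubspace_E]) (auto simp: cinner_linear cinner_proj_right)

lemma proj_scaleC: "proj j (c *\<^sub>C x) = c *\<^sub>C proj j x"
  by (intro proj_eqI complex_vector.subspace_scale[OF csubspace_E]) (auto simp: cinner_linear cinner_proj_right)

lemma proj_scaleR: "proj j (r *\<^sub>R x) = r *\<^sub>R proj j x"
  using proj_scaleC[of j "of_real r"] by (simp add: scaleC_of_real)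

lemma proj_same: "e \<in> E j \<Longrightarrow> proj j e = e"
  by (rule proj_eqI) auto

lemma proj_other: "e \<in> E i \<Longrightarrow> i \<noteq> j \<Longrightarrow> proj j e = 0"
  by (intro proj_eqI complex_vector.subspace_0[OF csubspace_E])
    (auto simp: orthogonal[of j i])

lemma cinner_proj_both: "cinner (proj j x) (proj j y) = cinner (proj j x) y"
  by (simp add: cinner_proj_right)

lemma cinner_proj_proj: "cinner x (proj j y) = cinner (proj j x) (proj j y)"
  by (metis cinner_commute cinner_proj_right proj_in)

lemma proj_ext:
  assumes "\<And>j. proj j x = proj j y"
  shows "x = y"
proof -
  have "cinner e (x - y) = 0" if "e \<in> E j" for e j
    using assms[of j] cinner_proj_right[OF that, of x] cinner_proj_right[OF that, of y]
    by (simp add: cinner_diff_right)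
  then show ?thesis
    using total[of "x - y"] by simp
qed

lemma norm_sum_orthogonal:
  assumes a: "\<And>j. a j \<in> E j" and F: "finite F"
  shows "(norm (sum a F))\<^sup>2 = (\<Sum>j\<in>F. (norm (a j))\<^sup>2)"
proof -
  have "inner (a i) (a j) = 0" if "i \<noteq> j" for i j
    using orthogonal[OF that a a] by (simp add: inner_eq_Re_cinner)
  then show ?thesis
    using F by (intro norm_sum_Pythagorean) (auto simp: pairwise_def orthogonal_def)
qed

text \<open>By Pythagoras, square summable components have Cauchy partial sums.\<close>

lemma components_sums:
  assumes a: "\<And>j. a j \<in> E j" and sq: "summable (\<lambda>j. (norm (a j))\<^sup>2)"
  shows "\<exists>s. a sums s \<and> (\<forall>j. proj j s = a j)"
proof -
  have "Cauchy (\<lambda>n. sum a {..<n})"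
  proof (rule CauchyI')
    fix e :: real assume e: "e > 0"
    then obtain N where N: "\<And>m n. m \<ge> N \<Longrightarrow> norm (\<Sum>j=m..<n. (norm (a j))\<^sup>2) < e\<^sup>2"
      using sq unfolding summable_Cauchy by (meson zero_less_power)
    have "norm (sum a {..<m} - sum a {..<n}) < e" if "m \<ge> N" "n > m" for m n
    proof -
      have "sum a {..<n} - sum a {..<m} = sum a {m..<n}"
        using \<open>n > m\<close> by (simp add: lessThan_atLeast0 sum_diff_nat_ivl)
      then have "(norm (sum a {..<m} - sum a {..<n}))\<^sup>2 = (\<Sum>j=m..<n. (norm (a j))\<^sup>2)"
        by (metis finite_atLeastLessThan norm_minus_commute norm_sum_orthogonal a)
      also have "\<dots> < e\<^sup>2"
        using N[OF \<open>m \<ge> N\<close>, of n] by simp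
      finally show ?thesis
        using e by (simp add: power2_less_imp_less)
    qed
    then show "\<exists>M. \<forall>m\<ge>M. \<forall>n>m. dist (sum a {..<m}) (sum a {..<n}) < e"
      unfolding dist_norm by blast
  qed
  then obtain s where s: "a sums s"
    using Cauchy_convergent convergent_def sums_def by blast
  have "proj j s = a j" for j
  proof (rule proj_eqI[OF a])
    fix e assume e: "e \<in> E j"
    \<comment> \<open>By orthogonality only the term \<open>i = j\<close> survives.\<close>
    have "(\<lambda>i. cinner e (a i)) sums (\<Sum>i\<in>{j}. cinner e (a i))"
      by (rule sums_finite) (auto intro: orthogonal[OF _ e a])
    then show "cinner e (a j) = cinner e s"
      using sums_unique2[OF _ cinner_sums_right[OF s, of e]] by simp
  qed
  with s show ?thesis
    by blast
qed

lemma bessel: "(\<Sum>j<n. (norm (proj j x))\<^sup>2) \<le> (norm x)\<^sup>2"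
proof -
  define s where "s = (\<Sum>j<n. proj j x)"
  have s: "(norm s)\<^sup>2 = (\<Sum>j<n. (norm (proj j x))\<^sup>2)"
    unfolding s_def by (rule norm_sum_orthogonal) auto
  have "inner (proj j x) x = (norm (proj j x))\<^sup>2" for j
    using cinner_proj_both[of j x x, symmetric] by (simp add: inner_eq_Re_cinner cinner_self)
  then have "inner s x = (norm s)\<^sup>2"
    unfolding s by (simp add: s_def inner_sum_left)
  then have "(norm (x - s))\<^sup>2 = (norm x)\<^sup>2 - (norm s)\<^sup>2"
    by (simp add: power2_norm_eq_inner inner_diff_left inner_diff_right inner_commute)
  then show ?thesis
    unfolding s[symmetric] by (smt (verit) zero_le_power2)
qed

lemma summable_norm_proj: "summable (\<lambda>j. (norm (proj j x))\<^sup>2)"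
  by (rule summableI_nonneg_bounded[OF _ bessel]) simp

lemma proj_sums: "(\<lambda>j. proj j x) sums x"
proof -
  obtain s where "(\<lambda>j. proj j x) sums s" "\<And>j. proj j s = proj j x"
    using components_sums[of "\<lambda>j. proj j x"] summable_norm_proj by auto
  then show ?thesis
    using proj_ext by metis
qed

lemma cinner_sums: "(\<lambda>j. cinner (proj j x) (proj j y)) sums cinner x y"
  using cinner_sums_right[OF proj_sums, of x y] by (simp add: cinner_proj_proj[of x])

lemma norm_sums: "(\<lambda>j. (norm (proj j x))\<^sup>2) sums (norm x)\<^sup>2"
  using sums_Re[OF cinner_sums[of x x]] by (simp add: cinner_self)

text \<open>For an unbounded weight \<open>d\<close> the series may diverge; all facts about \<open>diag d\<close> below are
  for bounded weights.\<close>

definition diag :: "(nat \<Rightarrow> real) \<Rightarrow> 'h \<Rightarrow> 'h" where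
  "diag d x = (\<Sum>j. d j *\<^sub>R proj j x)"

lemma proj_diag:
  assumes "bounded (range d)"
  shows "proj j (diag d x) = d j *\<^sub>R proj j x"
proof -
  obtain C where C: "\<And>j. \<bar>d j\<bar> \<le> C"
    using assms by (auto simp: bounded_iff)
  have "(d j)\<^sup>2 \<le> C\<^sup>2" for j
    using power_mono[OF C abs_ge_zero, of j 2] by simp
  then have "summable (\<lambda>j. (norm (d j *\<^sub>R proj j x))\<^sup>2)"
    by (intro summable_comparison_test[OF _ summable_mult[OF summable_norm_proj, of "C\<^sup>2" x]])
      (auto simp: power_mult_distrib mult_right_mono)
  moreover have "d j *\<^sub>R proj j x \<in> E j" for j
    using subspace_if_csubspace[OF csubspace_E] by (simp add: subspace_scale)
  ultimately obtain s where "(\<lambda>j. d j *\<^sub>R proj j x) sums s" "\<And>j. proj j s = d j *\<^sub>R proj j x"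
    using components_sums[of "\<lambda>j. d j *\<^sub>R proj j x"] by auto
  then show ?thesis
    by (simp add: diag_def sums_iff)
qed

lemma diag_add: "bounded (range d) \<Longrightarrow> diag d (x + y) = diag d x + diag d y"
  by (rule proj_ext) (simp add: proj_diag proj_add scaleR_add_right)

lemma diag_diff: "bounded (range d) \<Longrightarrow> diag d (x - y) = diag d x - diag d y"
  by (rule proj_ext) (simp add: proj_diag proj_diff scaleR_diff_right)

lemma diag_scaleC: "bounded (range d) \<Longrightarrow> diag d (c *\<^sub>C x) = c *\<^sub>C diag d x"
  by (rule proj_ext) (simp add: proj_diag proj_scaleC scaleC_scaleC mult.commute
      flip: scaleC_of_real)

lemma diag_selfadjoint: "bounded (range d) \<Longrightarrow> cinner (diag d x) y = cinner x (diag d y)"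
  using cinner_sums[of "diag d x" y] cinner_sums[of x "diag d y"]
  by (auto simp: proj_diag cinner_linear intro: sums_unique2)

lemma norm_diag_sums:
  "bounded (range d) \<Longrightarrow> (\<lambda>j. (d j)\<^sup>2 * (norm (proj j x))\<^sup>2) sums (norm (diag d x))\<^sup>2"
  using norm_sums[of "diag d x"] by (simp add: proj_diag power_mult_distrib)

lemma cinner_diag_sums:
  "bounded (range d) \<Longrightarrow>
    (\<lambda>j. d j * (norm (proj j x))\<^sup>2) sums Re (cinner x (diag d x))"
  using sums_Re[OF cinner_sums[of x "diag d x"]] by (simp add: proj_diag cinner_linear cinner_self)

lemma norm_diag_le:
  assumes C: "\<And>j. \<bar>d j\<bar> \<le> C"
  shows "norm (diag d x) \<le> C * norm x"
proof -
  have d: "bounded (range d)"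
    using C by (auto simp: bounded_iff)
  have "C \<ge> 0"
    using C[of 0] by linarith
  have "(d j)\<^sup>2 \<le> C\<^sup>2" for j
    using power_mono[OF C abs_ge_zero, of j 2] by simp
  then have "(norm (diag d x))\<^sup>2 \<le> C\<^sup>2 * (norm x)\<^sup>2"
    by (intro sums_le[OF _ norm_diag_sums[OF d] sums_mult[OF norm_sums]]) (simp add: mult_right_mono)
  then have "(norm (diag d x))\<^sup>2 \<le> (C * norm x)\<^sup>2"
    unfolding power_mult_distrib .
  then show ?thesis
    by (rule power2_le_imp_le) (use \<open>C \<ge> 0\<close> in simp)
qed

end


section \<open>Self-adjoint operators and compact positive operators\<close>

lemma op_adjoint_eq_Some_iff:
  fixes T :: "'a::complex_inner \<rightharpoonup> 'a"
  assumes dense: "closure (dom T) = UNIV"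
  shows "op_adjoint T v = Some w \<longleftrightarrow> (\<forall>u\<in>dom T. cinner (the (T u)) v = cinner u w)"
proof -
  have unique: "y = z" if y: "\<forall>u\<in>dom T. cinner (the (T u)) v = cinner u y"
    and z: "\<forall>u\<in>dom T. cinner (the (T u)) v = cinner u z" for y z
  proof -
    have "inner u (y - z) = 0" if "u \<in> dom T" for u
    proof -
      have "cinner u y = cinner u z"
        using y z that by (metis (lifting))
      then show ?thesis
        by (simp add: inner_eq_Re_cinner cinner_diff_right)
    qed
    then have "dom T \<subseteq> {u. inner u (y - z) = 0}"
      by blast
    moreover have "closed {u. inner u (y - z) = 0}"
      by (intro closed_Collect_eq continuous_intros)
    ultimately have "closure (dom T) \<subseteq> {u. inner u (y - z) = 0}"
      by (rule closure_minimal)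
    then have "inner (y - z) (y - z) = 0"
      unfolding dense by blast
    then show ?thesis
      by simp
  qed
  show ?thesis
  proof (cases "\<exists>z. \<forall>u\<in>dom T. cinner (the (T u)) v = cinner u z")
    case True
    then obtain z where z: "\<forall>u\<in>dom T. cinner (the (T u)) v = cinner u z"
      by blast
    then have "(THE z. \<forall>u\<in>dom T. cinner (the (T u)) v = cinner u z) = z"
      by (intro the_equality unique)
    then have "op_adjoint T v = Some z"
      unfolding op_adjoint_def if_P[OF True] by simp
    then show ?thesis
      using unique z by (metis option.inject)
  qed (auto simp: op_adjoint_def)
qed

lemma selfadjoint_op_eq_Some_iff:
  assumes "selfadjoint_op T"
  shows "T v = Some w \<longleftrightarrow> (\<forall>u\<in>dom T. cinner (the (T u)) v = cinner u w)"
  using op_adjoint_eq_Some_iff[of T v w] assms by (simp add: selfadjoint_op_def)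

lemma selfadjoint_op_symmetric:
  assumes "selfadjoint_op T" "u \<in> dom T" "v \<in> dom T"
  shows "cinner (the (T u)) v = cinner u (the (T v))"
  using selfadjoint_op_eq_Some_iff[OF assms(1), of v "the (T v)"] assms(2,3) by auto

lemma selfadjoint_op_closed_graph:
  assumes T: "selfadjoint_op T"
    and u: "\<And>n. u n \<in> dom T" "u \<longlonglongrightarrow> v" "(\<lambda>n. the (T (u n))) \<longlonglongrightarrow> w"
  shows "T v = Some w"
proof -
  have "cinner (the (T y)) v = cinner y w" if y: "y \<in> dom T" for y
  proof (rule LIMSEQ_unique)
    show "(\<lambda>n. cinner (the (T y)) (u n)) \<longlonglongrightarrow> cinner (the (T y)) v"
      by (intro tendsto_cinner tendsto_const u)
    have "(\<lambda>n. cinner y (the (T (u n)))) \<longlonglongrightarrow> cinner y w"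
      by (intro tendsto_cinner tendsto_const u)
    then show "(\<lambda>n. cinner (the (T y)) (u n)) \<longlonglongrightarrow> cinner y w"
      by (simp add: selfadjoint_op_symmetric[OF T y u(1)])
  qed
  then show ?thesis
    by (simp add: selfadjoint_op_eq_Some_iff[OF T])
qed

lemma mem_eigenspace_iff: "u \<in> eigenspace T z \<longleftrightarrow> T u = Some (z *\<^sub>C u)"
  by (auto simp: eigenspace_def)

context
  fixes T :: "'a::complex_inner \<rightharpoonup> 'a"
  assumes T: "linear_op T"
begin

lemma linear_op_add: "u \<in> dom T \<Longrightarrow> v \<in> dom T \<Longrightarrow> T (u + v) = Some (the (T u) + the (T v))"
  using T complex_vector.subspace_add[of "dom T" u v]
  by (metis linear_op_def domIff option.collapse)

lemma linear_op_scaleC: "u \<in> dom T \<Longrightarrow> T (c *\<^sub>C u) = Some (c *\<^sub>C the (T u))"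
  using T complex_vector.subspace_scale[of "dom T" u c]
  by (metis linear_op_def domIff option.collapse)

lemma linear_op_diff: "u \<in> dom T \<Longrightarrow> v \<in> dom T \<Longrightarrow> T (u - v) = Some (the (T u) - the (T v))"
  using linear_op_add[of u "(-1) *\<^sub>C v"] linear_op_scaleC[of v "-1"]
  by (simp add: domIff)

lemma linear_op_0: "T 0 = Some 0"
  using T complex_vector.subspace_0[of "dom T"] linear_op_scaleC[of 0 0]
  by (auto simp: linear_op_def)

lemma csubspace_eigenspace: "csubspace (eigenspace T z)"
proof (rule complex_vector.subspaceI)
  show "0 \<in> eigenspace T z"
    by (simp add: mem_eigenspace_iff linear_op_0)
  show "u + v \<in> eigenspace T z" if "u \<in> eigenspace T z" "v \<in> eigenspace T z" for u v
    using that linear_op_add[of u v] by (auto simp: mem_eigenspace_iff scaleC_add_right)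
  show "c *\<^sub>C u \<in> eigenspace T z" if "u \<in> eigenspace T z" for c u
    using that linear_op_scaleC[of u c]
    by (auto simp: mem_eigenspace_iff scaleC_scaleC mult.commute)
qed

end

lemma closed_eigenspace:
  assumes T: "selfadjoint_op T"
  shows "closed (eigenspace T z)"
  unfolding closed_sequential_limits
proof (intro allI impI, elim conjE)
  fix u v assume u: "\<forall>n. u n \<in> eigenspace T z" "u \<longlonglongrightarrow> v"
  show "v \<in> eigenspace T z"
    unfolding mem_eigenspace_iff
  proof (rule selfadjoint_op_closed_graph[OF T])
    show "(\<lambda>n. the (T (u n))) \<longlonglongrightarrow> z *\<^sub>C v"
      using tendsto_scaleC[OF u(2), of z] u(1) by (simp add: mem_eigenspace_iff)
  qed (use u in \<open>auto simp: eigenspace_def\<close>)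
qed

lemma eigenspaces_orthogonal:
  assumes T: "selfadjoint_op T" and "x \<in> eigenspace T (of_real a)" "y \<in> eigenspace T (of_real b)"
    and "a \<noteq> b"
  shows "cinner x y = 0"
proof -
  have "of_real a * cinner x y = of_real b * cinner x y"
    using selfadjoint_op_symmetric[OF T, of x y] assms
    by (simp add: eigenspace_def cinner_linear)
  then show ?thesis
    using \<open>a \<noteq> b\<close> by simp
qed

text \<open>The quadratic polynomial \<open>t \<mapsto> (x + t y, M (x + t y))\<close> is nonnegative; evaluating it at
  its minimum, or far out if it is affine, gives the claim.\<close>

lemma form_cauchy_schwarz:
  fixes M :: "'a::real_inner \<Rightarrow> 'a"
  assumes M: "linear M" and sym: "\<And>x y. inner (M x) y = inner x (M y)"
    and pos: "\<And>x. inner x (M x) \<ge> 0"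
  shows "(inner x (M y))\<^sup>2 \<le> inner x (M x) * inner y (M y)"
proof -
  define c where "c = inner x (M y)"
  have quad: "0 \<le> inner x (M x) + 2 * t * c + t\<^sup>2 * inner y (M y)" for t
  proof -
    have "inner (x + t *\<^sub>R y) (M (x + t *\<^sub>R y))
        = inner x (M x) + 2 * t * c + t\<^sup>2 * inner y (M y)"
      using sym[of x y]
      by (simp add: linear_add[OF M] linear_scale[OF M] inner_add_left inner_add_right c_def
          inner_commute[of y "M x"] algebra_simps power2_eq_square)
    then show ?thesis
      using pos[of "x + t *\<^sub>R y"] by simp
  qed
  show ?thesis
  proof (cases "inner y (M y) = 0")
    case True
    have "c = 0"
    proof (rule ccontr)
      assume "c \<noteq> 0"
      then show False
        using quad[of "- (inner x (M x) + 1) / (2 * c)"] True by (simp add: field_simps)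
    qed
    then show ?thesis
      using True c_def by simp
  next
    case False
    then have "inner y (M y) > 0"
      using pos[of y] by simp
    then have "c\<^sup>2 \<le> inner x (M x) * inner y (M y)"
      using quad[of "- c / inner y (M y)"] by (simp add: field_simps power2_eq_square)
    then show ?thesis
      unfolding c_def .
  qed
qed

text \<open>Let \<open>m\<close> be the supremum of the quadratic form of \<open>M\<close> on the unit sphere of \<open>W\<close>. The
  Cauchy-Schwarz inequality for this form bounds the square of \<open>\<parallel>M x - m x\<parallel>\<close> by
  \<open>m (m - (x, M x))\<close>, so a maximising sequence consists of approximate eigenvectors, and
  compactness turns a subsequence into an exact one.\<close>

theorem compact_positive_eigenvector:
  fixes M :: "'a::real_inner \<Rightarrow> 'a"
  assumes M: "bounded_linear M" and sym: "\<And>x y. inner (M x) y = inner x (M y)"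
    and pos: "\<And>x. inner x (M x) \<ge> 0"
    and compact: "\<And>x :: nat \<Rightarrow> 'a. (\<And>n. norm (x n) \<le> 1) \<Longrightarrow>
      \<exists>l r. strict_mono r \<and> (\<lambda>n. M (x (r n))) \<longlonglongrightarrow> l"
    and W: "subspace W" "closed W" "\<And>x. x \<in> W \<Longrightarrow> M x \<in> W"
    and w: "w \<in> W" "M w \<noteq> 0"
  shows "\<exists>m>0. \<exists>x\<in>W. x \<noteq> 0 \<and> M x = m *\<^sub>R x"
proof -
  interpret M: bounded_linear M by (rule M)
  note cs = form_cauchy_schwarz[OF M.linear_axioms sym pos]
  define Q where "Q x = inner x (M x)" for x
  define X where "X = {x \<in> W. norm x = 1}"
  define m where "m = (SUP x\<in>X. Q x)"
  have "w \<noteq> 0"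
    using w(2) M.zero by auto
  then have "(1 / norm w) *\<^sub>R w \<in> X"
    using w(1) W(1) by (simp add: X_def subspace_scale)
  then have ne: "X \<noteq> {}"
    by blast
  obtain K where K: "\<And>x. norm (M x) \<le> norm x * K"
    using M.bounded by blast
  have bdd: "bdd_above (Q ` X)"
  proof (rule bdd_aboveI2)
    fix x assume "x \<in> X"
    then have "Q x \<le> 1 * norm (M x)" "norm (M x) \<le> K"
      using norm_cauchy_schwarz[of x "M x"] K[of x] by (simp_all add: X_def Q_def)
    then show "Q x \<le> K"
      by simp
  qed
  have Q_le: "Q x \<le> m * (norm x)\<^sup>2" if "x \<in> W" for x
  proof (cases "x = 0")
    case False
    then have "(1 / norm x) *\<^sub>R x \<in> X"
      using that W(1) by (simp add: X_def subspace_scale)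
    then have "Q ((1 / norm x) *\<^sub>R x) \<le> m"
      unfolding m_def using bdd by (rule cSUP_upper)
    then show ?thesis
      using False by (simp add: Q_def M.scaleR field_simps power2_eq_square)
  qed (simp add: Q_def M.zero)
  have M_le: "(norm (M x))\<^sup>2 \<le> m * Q x" if "x \<in> W" for x
  proof (cases "M x = 0")
    case True
    then show ?thesis
      by (simp add: Q_def)
  next
    case False
    have "((norm (M x))\<^sup>2)\<^sup>2 \<le> Q (M x) * Q x"
      using cs[of "M x" x] by (simp add: Q_def power2_norm_eq_inner)
    also have "\<dots> \<le> m * (norm (M x))\<^sup>2 * Q x"
      using Q_le[OF W(3)[OF that]] pos[of x] by (intro mult_right_mono) (simp_all add: Q_def)
    finally show ?thesis
      using False by (simp add: power2_eq_square)
  qed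
  have "m > 0"
  proof -
    have "0 < m * Q w"
      using M_le[OF w(1)] w(2) by (meson less_le_trans zero_less_norm_iff zero_less_power)
    then show ?thesis
      using pos[of w] by (simp add: Q_def zero_less_mult_iff)
  qed
  have "\<exists>x\<in>X. m - 1 / real (Suc n) < Q x" for n
    using less_cSUP_iff[OF ne bdd, of "m - 1 / real (Suc n)"] by (simp add: m_def)
  then obtain x where x: "\<And>n. x n \<in> X" "\<And>n. m - 1 / real (Suc n) < Q (x n)"
    by metis
  have xW: "x n \<in> W" "norm (x n) = 1" for n
    using x(1)[of n] by (auto simp: X_def)
  have residual: "(norm (M (x n) - m *\<^sub>R x n))\<^sup>2 \<le> m * (1 / real (Suc n))" for n
  proof -
    have "(norm (M (x n) - m *\<^sub>R x n))\<^sup>2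
        = (norm (M (x n)))\<^sup>2 - 2 * m * Q (x n) + m\<^sup>2 * (norm (x n))\<^sup>2"
      unfolding power2_norm_eq_inner Q_def
      by (simp add: inner_diff_left inner_diff_right inner_commute[of "M (x n)" "x n"]
          algebra_simps power2_eq_square)
    also have "\<dots> \<le> m * (m - Q (x n))"
      using M_le[OF xW(1)[of n]] xW(2)[of n] by (simp add: algebra_simps power2_eq_square)
    also have "\<dots> \<le> m * (1 / real (Suc n))"
      using x(2)[of n] \<open>m > 0\<close> by (intro mult_left_mono) linarith+
    finally show ?thesis .
  qed
  have "(\<lambda>n. (norm (M (x n) - m *\<^sub>R x n))\<^sup>2) \<longlonglongrightarrow> 0"
  proof (rule tendsto_sandwich[OF _ _ tendsto_const])
    have "(\<lambda>n. m * (1 / real (Suc n))) \<longlonglongrightarrow> m * 0"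
      by (intro tendsto_intros LIMSEQ_Suc lim_1_over_n)
    then show "(\<lambda>n. m * (1 / real (Suc n))) \<longlonglongrightarrow> 0"
      by simp
  qed (use residual in auto)
  then have "(\<lambda>n. sqrt ((norm (M (x n) - m *\<^sub>R x n))\<^sup>2)) \<longlonglongrightarrow> sqrt 0"
    by (rule tendsto_real_sqrt)
  then have res0: "(\<lambda>n. M (x n) - m *\<^sub>R x n) \<longlonglongrightarrow> 0"
    using tendsto_norm_zero_iff by fastforce
  obtain l r where r: "strict_mono r" "(\<lambda>n. M (x (r n))) \<longlonglongrightarrow> l"
    using compact[of x] xW(2) by (metis order_refl)
  have "(\<lambda>n. M (x (r n)) - m *\<^sub>R x (r n)) \<longlonglongrightarrow> 0"
    using LIMSEQ_subseq_LIMSEQ[OF res0 r(1)] by (simp add: o_def)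
  from tendsto_diff[OF r(2) this] have l: "(\<lambda>n. m *\<^sub>R x (r n)) \<longlonglongrightarrow> l"
    by simp
  have "l \<in> W"
    using closed_sequentially[OF W(2) _ l] xW(1) subspace_scale[OF W(1)] by blast
  have "norm l = m"
    using tendsto_norm[OF l] \<open>m > 0\<close> xW(2) by (simp add: LIMSEQ_const_iff)
  have "(\<lambda>n. M (m *\<^sub>R x (r n))) \<longlonglongrightarrow> M l"
    by (rule M.tendsto[OF l])
  moreover have "(\<lambda>n. M (m *\<^sub>R x (r n))) \<longlonglongrightarrow> m *\<^sub>R l"
    unfolding M.scaleR by (intro tendsto_scaleR tendsto_const r(2))
  ultimately have "M l = m *\<^sub>R l"
    by (rule LIMSEQ_unique)
  then show ?thesis
    using \<open>l \<in> W\<close> \<open>norm l = m\<close> \<open>m > 0\<close> norm_zero by (metis less_irrefl)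
qed


section \<open>Totality of the eigenvectors\<close>

locale positive_selfadjoint =
  fixes L :: "'h::{complex_inner, complete_space} \<rightharpoonup> 'h"
  assumes selfadjoint: "selfadjoint_op L" and positive: "positive_op L"
begin

lemma linear_L: "linear_op L"
  using selfadjoint by (simp add: selfadjoint_op_def)

lemma inner_nonneg: "u \<in> dom L \<Longrightarrow> inner u (the (L u)) \<ge> 0"
  using positive by (auto simp: positive_op_def inner_eq_Re_cinner complex_nonneg_Reals_iff)

lemma norm_le_norm_plus_one:
  assumes "u \<in> dom L"
  shows "norm u \<le> norm (the (L u) + u)"
proof (cases "u = 0")
  case False
  have "norm u * norm u \<le> inner u (the (L u) + u)"
    using inner_nonneg[OF assms] by (simp add: inner_add_right power2_norm_eq_inner[symmetric] power2_eq_square)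
  also have "\<dots> \<le> norm u * norm (the (L u) + u)"
    by (rule norm_cauchy_schwarz)
  finally show ?thesis
    using False by simp
qed simp

text \<open>The range of \<open>L + 1\<close> is closed because \<open>L + 1\<close> is bounded below and has a closed
  graph. It is dense because a vector orthogonal to it is an eigenvector of the adjoint \<open>L\<close>
  for the eigenvalue \<open>-1\<close>, which positivity excludes.\<close>

lemma plus_one_surj: "\<exists>u\<in>dom L. the (L u) + u = f"
proof -
  define V where "V = (\<lambda>u. the (L u) + u) ` dom L"
  have sub: "csubspace (dom L)"
    using linear_L by (simp add: linear_op_def)
  have V_scale: "c *\<^sub>C v \<in> V" if "v \<in> V" for c v
  proof -
    obtain u where u: "u \<in> dom L" "v = the (L u) + u"
      using \<open>v \<in> V\<close> by (auto simp: V_def)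
    have "c *\<^sub>C v = the (L (c *\<^sub>C u)) + c *\<^sub>C u"
      using linear_op_scaleC[OF linear_L u(1), of c] u(2) by (simp add: scaleC_add_right)
    then show ?thesis
      using complex_vector.subspace_scale[OF sub u(1)] by (auto simp: V_def)
  qed
  have V: "subspace V"
  proof (rule subspace_if_csubspace, rule complex_vector.subspaceI)
    show "0 \<in> V"
      using linear_op_0[OF linear_L] by (force simp: V_def)
    show "v + w \<in> V" if v: "v \<in> V" and w: "w \<in> V" for v w
    proof -
      obtain a b where ab: "a \<in> dom L" "v = the (L a) + a" "b \<in> dom L" "w = the (L b) + b"
        using v w by (auto simp: V_def)
      have "v + w = the (L (a + b)) + (a + b)"
        using linear_op_add[OF linear_L ab(1,3)] ab(2,4) by simp
      then show ?thesis
        using complex_vector.subspace_add[OF sub ab(1,3)] by (auto simp: V_def)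
    qed
  qed (rule V_scale)
  have "closure V = UNIV"
  proof (rule dense_subspaceI[OF V])
    fix w assume w: "\<And>v. v \<in> V \<Longrightarrow> inner v w = 0"
    have "cinner (the (L u)) w = cinner u (- w)" if u: "u \<in> dom L" for u
    proof -
      have v: "the (L u) + u \<in> V"
        using u by (auto simp: V_def)
      have "cinner (the (L u) + u) w = 0"
        using w[OF v] w[OF V_scale[OF v, of \<i>]]
        by (simp add: inner_eq_Re_cinner cinner_scaleC_left complex_eq_iff)
      then show ?thesis
        by (simp add: cinner_add_left add_eq_0_iff2)
    qed
    then have Lw: "L w = Some (- w)"
      by (simp add: selfadjoint_op_eq_Some_iff[OF selfadjoint])
    then have "inner w w \<le> 0"
      using inner_nonneg[of w] by (auto simp: inner_minus_right)
    then show "w = 0"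
      using inner_ge_zero[of w] by (metis inner_eq_zero_iff order_antisym)
  qed
  then obtain v where v: "\<And>n. v n \<in> V" "v \<longlonglongrightarrow> f"
    using closure_sequential[of f V] by auto
  then obtain u where u: "\<And>n. u n \<in> dom L" "\<And>n. v n = the (L (u n)) + u n"
    unfolding V_def image_iff by metis
  have "Cauchy u"
  proof (rule metric_CauchyI)
    fix e :: real assume "e > 0"
    then obtain N where N: "\<And>m n. m \<ge> N \<Longrightarrow> n \<ge> N \<Longrightarrow> dist (v m) (v n) < e"
      using LIMSEQ_imp_Cauchy[OF v(2)] metric_CauchyD by blast
    have "dist (u m) (u n) \<le> dist (v m) (v n)" for m n
      using norm_le_norm_plus_one[of "u m - u n"] linear_op_diff[OF linear_L u(1)[of m] u(1)[of n]]
      by (auto simp: dist_norm u(2) algebra_simps)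
    then show "\<exists>N. \<forall>m\<ge>N. \<forall>n\<ge>N. dist (u m) (u n) < e"
      using N le_less_trans by blast
  qed
  then obtain z where z: "u \<longlonglongrightarrow> z"
    using Cauchy_convergent convergent_def by blast
  have "(\<lambda>n. the (L (u n))) \<longlonglongrightarrow> f - z"
    using tendsto_diff[OF v(2) z] by (simp add: u(2))
  then have "L z = Some (f - z)"
    by (rule selfadjoint_op_closed_graph[OF selfadjoint u(1) z])
  then show ?thesis
    by force
qed

definition inverse_plus_one :: "'h \<Rightarrow> 'h" where
  "inverse_plus_one f = (SOME u. u \<in> dom L \<and> the (L u) + u = f)"

lemma inverse_plus_one:
  "inverse_plus_one f \<in> dom L" "the (L (inverse_plus_one f)) + inverse_plus_one f = f"
  using someI_ex[of "\<lambda>u. u \<in> dom L \<and> the (L u) + u = f"] plus_one_surj[of f]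
  unfolding inverse_plus_one_def by blast+

lemma inverse_plus_one_eqI:
  assumes u: "L u = Some v" and "v + u = f"
  shows "inverse_plus_one f = u"
proof -
  have "u \<in> dom L"
    using u by blast
  then have "the (L (inverse_plus_one f - u)) = (f - inverse_plus_one f) - v"
    and "inverse_plus_one f - u \<in> dom L"
    using linear_op_diff[OF linear_L inverse_plus_one(1), of u f] inverse_plus_one(2)[of f] u
    by (auto simp: algebra_simps)
  then have "norm (inverse_plus_one f - u) \<le> norm ((f - inverse_plus_one f) - v + (inverse_plus_one f - u))"
    using norm_le_norm_plus_one[of "inverse_plus_one f - u"] by simp
  also have "\<dots> = 0"
    using \<open>v + u = f\<close> by (simp add: algebra_simps)
  finally show ?thesis
    by simp
qed

lemma inverse_plus_one_graph: "L (inverse_plus_one f) = Some (f - inverse_plus_one f)"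
proof -
  obtain v where v: "L (inverse_plus_one f) = Some v"
    using inverse_plus_one(1) by blast
  then show ?thesis
    using inverse_plus_one(2)[of f] by (auto simp: algebra_simps)
qed

lemma cinner_inverse_plus_one:
  "cinner (inverse_plus_one x) y = cinner x (inverse_plus_one y)"
  using selfadjoint_op_symmetric[OF selfadjoint inverse_plus_one(1) inverse_plus_one(1), of x y]
  by (simp add: inverse_plus_one_graph cinner_linear)

lemma norm_inverse_plus_one: "norm (inverse_plus_one x) \<le> norm x"
  using norm_le_norm_plus_one[OF inverse_plus_one(1)] by (simp add: inverse_plus_one(2))

lemma bounded_linear_inverse_plus_one: "bounded_linear inverse_plus_one"
proof
  fix x y r
  show "inverse_plus_one (x + y) = inverse_plus_one x + inverse_plus_one y"
    using linear_op_add[OF linear_L inverse_plus_one(1) inverse_plus_one(1), of x y]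
    by (intro inverse_plus_one_eqI) (auto simp: inverse_plus_one_graph)
  show "inverse_plus_one (r *\<^sub>R x) = r *\<^sub>R inverse_plus_one x"
    using linear_op_scaleC[OF linear_L inverse_plus_one(1), of "of_real r" x]
    by (intro inverse_plus_one_eqI[of _ "r *\<^sub>R (x - inverse_plus_one x)"])
      (auto simp: inverse_plus_one_graph scaleC_of_real algebra_simps)
  show "\<exists>K. \<forall>x. norm (inverse_plus_one x) \<le> norm x * K"
    using norm_inverse_plus_one by (intro exI[of _ 1]) simp
qed

lemma inverse_plus_one_nonneg: "inner x (inverse_plus_one x) \<ge> 0"
proof -
  have "inner x (inverse_plus_one x)
      = inner (the (L (inverse_plus_one x)) + inverse_plus_one x) (inverse_plus_one x)"
    by (simp add: inverse_plus_one(2))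
  also have "\<dots> \<ge> 0"
    unfolding inner_add_left using inner_nonneg[OF inverse_plus_one(1)[of x]]
    by (simp add: inner_commute)
  finally show ?thesis .
qed

text \<open>The resolvent identity moves compactness from the given point \<open>z\<close> to \<open>-1\<close>:
  \<open>u = (L + 1)\<^sup>-\<^sup>1 f\<close> solves \<open>(L - z) u = f - (1 + z) u\<close>.\<close>

lemma inverse_plus_one_compact:
  fixes x :: "nat \<Rightarrow> 'h"
  assumes compact: "compact_resolvent L" and x: "\<And>n. norm (x n) \<le> 1"
  shows "\<exists>l r. strict_mono r \<and> (\<lambda>n. inverse_plus_one (x (r n))) \<longlonglongrightarrow> l"
proof -
  obtain z where z: "z \<in> resolvent_set UNIV norm L"
    and comp: "compact (closure (resolvent L z ` cball 0 1))"
    using compact by (auto simp: compact_resolvent_def)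
  have inj: "inj_on (\<lambda>u. the (L u) - z *\<^sub>C u) (dom L)"
    using z by (auto simp: resolvent_set_def bij_betw_def)
  \<comment> \<open>Dividing by \<open>s\<close> brings \<open>f - (1 + z) u\<close> into the unit ball when \<open>f\<close> lies in it.\<close>
  define s where "s = 1 + cmod (1 + z)"
  have s: "s > 0"
    by (simp add: s_def add_pos_nonneg)
  define y where "y n = (1 / s) *\<^sub>R inverse_plus_one (x n)" for n
  have "y n \<in> closure (resolvent L z ` cball 0 1)" for n
  proof -
    let ?u = "inverse_plus_one (x n)"
    have "L (y n) = Some ((1 / s) *\<^sub>R (x n - ?u))"
      using linear_op_scaleC[OF linear_L inverse_plus_one(1), of "of_real (1 / s)" "x n"]
      unfolding scaleC_of_real by (simp add: y_def inverse_plus_one_graph)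
    moreover have "z *\<^sub>C y n = (1 / s) *\<^sub>R (z *\<^sub>C ?u)"
      unfolding y_def by (simp add: scaleC_scaleC mult.commute flip: scaleC_of_real)
    ultimately have Lz: "the (L (y n)) - z *\<^sub>C y n = (1 / s) *\<^sub>R (x n - (1 + z) *\<^sub>C ?u)"
      and y: "y n \<in> dom L"
      by (auto simp: algebra_simps scaleC_add_left scaleC_of_real[of 1, simplified])
    have "norm (x n - (1 + z) *\<^sub>C ?u) \<le> norm (x n) + cmod (1 + z) * norm ?u"
      using norm_triangle_ineq4[of "x n" "(1 + z) *\<^sub>C ?u"] by simp
    also have "\<dots> \<le> s"
      using x[of n] norm_inverse_plus_one[of "x n"]
      unfolding s_def by (intro add_mono mult_left_le) auto
    finally have "the (L (y n)) - z *\<^sub>C y n \<in> cball 0 1"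
      using s by (simp add: Lz)
    moreover have "resolvent L z (the (L (y n)) - z *\<^sub>C y n) = y n"
      unfolding resolvent_def by (rule inv_into_f_f[OF inj y])
    ultimately have "y n \<in> resolvent L z ` cball 0 1"
      by (metis image_eqI)
    then show ?thesis
      by (rule subsetD[OF closure_subset])
  qed
  then obtain l r where r: "strict_mono r" "(y \<circ> r) \<longlonglongrightarrow> l"
    using seq_compactE[OF compact_imp_seq_compact[OF comp], of y] by blast
  from tendsto_scaleR[OF tendsto_const[of s] r(2)]
  have "(\<lambda>n. inverse_plus_one (x (r n))) \<longlonglongrightarrow> s *\<^sub>R l"
    using s by (simp add: y_def o_def)
  with r(1) show ?thesis
    by blast
qed

text \<open>The orthogonal complement of all eigenspaces is invariant under the compact operator
  \<open>(L + 1)\<^sup>-\<^sup>1\<close>. If it were nonzero, it would contain an eigenvector, which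
  would be orthogonal to itself.\<close>

theorem eigenvectors_total:
  assumes compact: "compact_resolvent L"
    and perp: "\<And>z e. e \<in> eigenspace L z \<Longrightarrow> cinner e w = 0"
  shows "w = 0"
proof (rule ccontr)
  assume "w \<noteq> 0"
  define W where "W = {w. \<forall>z. \<forall>e\<in>eigenspace L z. cinner e w = 0}"
  have W: "subspace W"
    by (auto simp: subspace_def W_def cinner_linear)
  have "closed W"
    unfolding closed_sequential_limits
  proof (intro allI impI, elim conjE)
    fix f l assume f: "\<forall>n. f n \<in> W" and l: "f \<longlonglongrightarrow> l"
    have "cinner e l = 0" if e: "e \<in> eigenspace L z" for z e
    proof (rule LIMSEQ_unique)
      show "(\<lambda>n. cinner e (f n)) \<longlonglongrightarrow> cinner e l"
        by (intro tendsto_cinner tendsto_const l)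
      show "(\<lambda>n. cinner e (f n)) \<longlonglongrightarrow> 0"
        using f e by (simp add: W_def)
    qed
    then show "l \<in> W"
      by (simp add: W_def)
  qed
  have invariant: "inverse_plus_one x \<in> W" if x: "x \<in> W" for x
  proof -
    have "cinner e (inverse_plus_one x) = 0" if e: "e \<in> eigenspace L z" for z e
    proof -
      have "inverse_plus_one e \<in> eigenspace L z"
      proof -
        have *: "the (L e) = z *\<^sub>C e" "e \<in> dom L"
          using e by (auto simp: eigenspace_def)
        have Le: "L e = Some (z *\<^sub>C e)"
          using e by (simp add: mem_eigenspace_iff)
        show ?thesis
        \<comment> \<open>At \<open>z = -1\<close> the factor \<open>1 / (z + 1)\<close> is undefined, but there the eigenspace is trivial.\<close>
        proof (cases "z = -1")
          case True
          have "norm e \<le> norm (z *\<^sub>C e + e)"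
            using norm_le_norm_plus_one[OF *(2)] *(1) by simp
          also have "z *\<^sub>C e + e = 0"
            unfolding True by simp
          finally have "e = 0"
            by simp
          then show ?thesis
            using True Le inverse_plus_one_eqI[of 0 0 0] linear_op_0[OF linear_L]
            by (simp add: mem_eigenspace_iff)
        next
          case False
          then have "z + 1 \<noteq> 0"
            by (simp add: add_eq_0_iff2)
          define e' where "e' = (1 / (z + 1)) *\<^sub>C e"
          have "L e' = Some ((1 / (z + 1)) *\<^sub>C z *\<^sub>C e)"
            using linear_op_scaleC[OF linear_L *(2), of "1 / (z + 1)"] *(1) by (simp add: e'_def)
          moreover have "(1 / (z + 1)) *\<^sub>C z *\<^sub>C e + e' = e"
            using \<open>z + 1 \<noteq> 0\<close>
            by (simp add: e'_def scaleC_scaleC add_divide_distrib[symmetric] flip: scaleC_add_left)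
          ultimately have "inverse_plus_one e = e'"
            by (rule inverse_plus_one_eqI)
          then show ?thesis
            using complex_vector.subspace_scale[OF csubspace_eigenspace[OF linear_L] e]
            by (simp add: e'_def)
        qed
      qed
      then show ?thesis
        using x cinner_inverse_plus_one[of e x] by (auto simp: W_def)
    qed
    then show ?thesis
      by (simp add: W_def)
  qed
  have "w \<in> W"
    using perp by (simp add: W_def)
  moreover have "inverse_plus_one w \<noteq> 0"
    using inverse_plus_one_graph[of w] linear_op_0[OF linear_L] \<open>w \<noteq> 0\<close> by auto
  moreover have "inner (inverse_plus_one x) y = inner x (inverse_plus_one y)" for x y
    by (simp add: inner_eq_Re_cinner cinner_inverse_plus_one)
  ultimately obtain m x where m: "m > 0" and x: "x \<in> W" "x \<noteq> 0" "inverse_plus_one x = m *\<^sub>R x"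
    using compact_positive_eigenvector[OF bounded_linear_inverse_plus_one _ inverse_plus_one_nonneg
        inverse_plus_one_compact[OF compact] W \<open>closed W\<close> invariant] by metis
  have "inverse_plus_one x \<in> dom L"
    by (rule inverse_plus_one(1))
  from linear_op_scaleC[OF linear_L this, of "of_real (1 / m)"]
  have "L x = Some ((1 / m) *\<^sub>R (x - m *\<^sub>R x))"
    unfolding scaleC_of_real inverse_plus_one_graph using m by (simp add: x(3))
  also have "(1 / m) *\<^sub>R (x - m *\<^sub>R x) = of_real (1 / m - 1) *\<^sub>C x"
    unfolding scaleC_of_real using m by (simp add: algebra_simps)
  finally have "x \<in> eigenspace L (of_real (1 / m - 1))"
    by (simp add: mem_eigenspace_iff)
  then have "cinner x x = 0"
    using x(1) by (auto simp: W_def)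
  then show False
    using x(2) by (simp add: cinner_self)
qed

end


section \<open>The square root of the operator\<close>

locale discrete_spectrum = positive_selfadjoint L
  for L :: "'h::{complex_inner, complete_space} \<rightharpoonup> 'h" +
  fixes lam :: "nat \<Rightarrow> real"
  assumes compact: "compact_resolvent L"
    and lam_0: "lam 0 = 0"
    and lam_mono: "strict_mono lam"
    and eigenvalues: "eigenvalues L = {complex_of_real (lam k) | k. k \<ge> 1}"
begin

lemma lam_pos: "j \<ge> 1 \<Longrightarrow> lam j > 0"
  using strict_monoD[OF lam_mono, of 0 j] lam_0 by simp

lemma lam_nonneg: "lam j \<ge> 0"
  using lam_pos[of j] lam_0 by (cases "j = 0") auto

lemma lam_ge: "j \<ge> 1 \<Longrightarrow> lam 1 \<le> lam j"
  using lam_mono by (simp add: strict_mono_less_eq)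

sublocale orthogonal_decomposition "\<lambda>j. eigenspace L (complex_of_real (lam j))"
proof
  show "cinner x y = 0" if "i \<noteq> j" "x \<in> eigenspace L (complex_of_real (lam i))"
    "y \<in> eigenspace L (complex_of_real (lam j))" for i j x y
    using that eigenspaces_orthogonal[OF selfadjoint] strict_mono_eq[OF lam_mono] by blast
  show "w = 0" if w: "\<And>j e. e \<in> eigenspace L (complex_of_real (lam j)) \<Longrightarrow> cinner e w = 0" for w
  proof (rule eigenvectors_total[OF compact])
    fix z e assume e: "e \<in> eigenspace L z"
    show "cinner e w = 0"
    proof (cases "e = 0")
      case False
      then have "z \<in> eigenvalues L"
        using e by (auto simp: eigenvalues_def)
      then show ?thesis
        using e w by (auto simp: eigenvalues)
    qed simp
  qed
qed (rule csubspace_eigenspace[OF linear_L], rule closed_eigenspace[OF selfadjoint])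

lemma proj_0: "proj 0 x = 0"
proof (rule ccontr)
  assume "proj 0 x \<noteq> 0"
  then have "complex_of_real (lam 0) \<in> eigenvalues L"
    using proj_in[of 0 x] by (auto simp: eigenvalues_def)
  then show False
    using lam_pos lam_0 by (force simp: eigenvalues)
qed

lemma proj_L:
  assumes u: "u \<in> dom L"
  shows "proj j (the (L u)) = lam j *\<^sub>R proj j u"
proof (rule proj_eqI)
  show "lam j *\<^sub>R proj j u \<in> eigenspace L (complex_of_real (lam j))"
    using complex_vector.subspace_scale[OF csubspace_E proj_in] by (simp flip: scaleC_of_real)
  fix e assume e: "e \<in> eigenspace L (complex_of_real (lam j))"
  then have "e \<in> dom L" "the (L e) = complex_of_real (lam j) *\<^sub>C e"
    by (auto simp: eigenspace_def)
  then show "cinner e (lam j *\<^sub>R proj j u) = cinner e (the (L u))"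
    using selfadjoint_op_symmetric[OF selfadjoint, of e u] u
    by (simp add: cinner_linear cinner_proj_right[OF e])
qed

text \<open>If \<open>v\<close> has the components of a would-be value of \<open>L\<close> at \<open>u\<close>, then Parseval's identity
  shows that \<open>u\<close> lies in the domain of the adjoint of \<open>L\<close> with value \<open>v\<close>, and the adjoint is
  \<open>L\<close> itself.\<close>

lemma L_eq_Some_iff: "L u = Some v \<longleftrightarrow> (\<forall>j. proj j v = lam j *\<^sub>R proj j u)"
proof
  assume "L u = Some v"
  then show "\<forall>j. proj j v = lam j *\<^sub>R proj j u"
    using proj_L[of u] by auto
next
  assume v: "\<forall>j. proj j v = lam j *\<^sub>R proj j u"
  have "cinner (the (L y)) u = cinner y v" if y: "y \<in> dom L" for y
  proof -
    have "(\<lambda>j. cinner (proj j (the (L y))) (proj j u)) = (\<lambda>j. cinner (proj j y) (proj j v))"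
      using v by (simp add: proj_L[OF y] cinner_linear)
    then show ?thesis
      using sums_unique2[OF cinner_sums[of "the (L y)" u]] cinner_sums[of y v] by simp
  qed
  then show "L u = Some v"
    by (simp add: selfadjoint_op_eq_Some_iff[OF selfadjoint])
qed

text \<open>\<open>G\<close> is \<open>L\<^sup>-\<^sup>1\<^sup>/\<^sup>2\<close>. At \<open>j = 0\<close> the weight is \<open>1 / 0 = 0\<close> and the component
  vanishes.\<close>

definition G :: "'h \<Rightarrow> 'h" where
  "G = diag (\<lambda>j. 1 / sqrt (lam j))"

lemma G_weight_le: "\<bar>1 / sqrt (lam j)\<bar> \<le> 1 / sqrt (lam 1)"
proof (cases "j = 0")
  case False
  then show ?thesis
    using lam_ge[of j] lam_pos[of 1] by (simp add: frac_le)
qed (use lam_0 lam_pos[of 1] in simp)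

lemma bounded_G_weight: "bounded (range (\<lambda>j. 1 / sqrt (lam j)))"
  using G_weight_le unfolding bounded_iff real_norm_def by blast

lemma proj_G: "proj j (G x) = (1 / sqrt (lam j)) *\<^sub>R proj j x"
  unfolding G_def by (rule proj_diag[OF bounded_G_weight])

lemma proj_eq_sqrt_proj_G: "proj j x = sqrt (lam j) *\<^sub>R proj j (G x)"
  using lam_pos[of j] by (cases "j = 0") (simp_all add: proj_G proj_0)

lemma G_eq_iff: "G x = G y \<longleftrightarrow> x = y"
  using proj_ext[of x y] proj_eq_sqrt_proj_G by metis

lemmas G_add = diag_add[OF bounded_G_weight, folded G_def]
  and G_diff = diag_diff[OF bounded_G_weight, folded G_def]
  and G_scaleC = diag_scaleC[OF bounded_G_weight, folded G_def]
  and G_selfadjoint = diag_selfadjoint[OF bounded_G_weight, folded G_def]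

lemma norm_G_le: "norm (G x) \<le> (1 / sqrt (lam 1)) * norm x"
  unfolding G_def by (rule norm_diag_le) (rule G_weight_le)

definition sqrt_L :: "'h \<rightharpoonup> 'h" where
  "sqrt_L u = (if u \<in> range G then Some (inv G u) else None)"

lemma sqrt_L_eq_Some_iff: "sqrt_L u = Some x \<longleftrightarrow> u = G x"
proof -
  have "inj G"
    by (rule injI) (simp add: G_eq_iff)
  then show ?thesis
    by (auto simp: sqrt_L_def inv_f_f)
qed

lemma dom_sqrt_L: "dom sqrt_L = range G"
  by (auto simp: dom_def sqrt_L_eq_Some_iff)

lemma sqrt_L_G [simp]: "sqrt_L (G x) = Some x"
  by (simp add: sqrt_L_eq_Some_iff)

lemma csubspace_range_G: "csubspace (range G)"
proof (rule complex_vector.subspaceI)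
  have "G 0 = 0"
    using G_diff[of 0 0] by simp
  then show "0 \<in> range G"
    by (metis rangeI)
qed (auto simp flip: G_add G_scaleC)

lemma dense_range_G: "closure (range G) = UNIV"
proof (rule dense_subspaceI)
  fix w assume w: "\<And>v. v \<in> range G \<Longrightarrow> inner v w = 0"
  then have "inner (G (G w)) w = 0"
    by blast
  then have "inner (G w) (G w) = 0"
    by (simp add: inner_eq_Re_cinner G_selfadjoint)
  then have "G w = G 0"
    using G_diff[of 0 0] by simp
  then show "w = 0"
    by (simp only: G_eq_iff)
qed (rule subspace_if_csubspace[OF csubspace_range_G])

text \<open>The inverse of a bounded injective self-adjoint operator is self-adjoint.\<close>

lemma selfadjoint_sqrt_L: "selfadjoint_op sqrt_L"
proof -
  have "op_adjoint sqrt_L v = Some w \<longleftrightarrow> sqrt_L v = Some w" for v w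
  proof -
    have "op_adjoint sqrt_L v = Some w \<longleftrightarrow> (\<forall>x. cinner x v = cinner x (G w))"
      by (simp add: op_adjoint_eq_Some_iff dom_sqrt_L dense_range_G G_selfadjoint)
    also have "\<dots> \<longleftrightarrow> sqrt_L v = Some w"
      using cinner_eqI[of v "G w"] by (auto simp: sqrt_L_eq_Some_iff)
    finally show ?thesis .
  qed
  then have "op_adjoint sqrt_L = sqrt_L"
    by (intro ext) (metis option.exhaust)
  moreover have "linear_op sqrt_L"
    using csubspace_range_G unfolding linear_op_def dom_sqrt_L
    by (auto simp flip: G_add G_scaleC)
  ultimately show ?thesis
    by (simp add: selfadjoint_op_def dom_sqrt_L dense_range_G)
qed

lemma positive_sqrt_L: "positive_op sqrt_L"
  unfolding positive_op_def dom_sqrt_L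
proof safe
  fix x
  have "cinner (G x) x = cnj (cinner (G x) x)"
    using cinner_commute[of "G x" x] by (simp add: G_selfadjoint)
  from arg_cong[OF this, of Im] have "Im (cinner (G x) x) = 0"
    by simp
  moreover have "Re (cinner x (G x)) \<ge> 0"
    unfolding G_def
    by (rule sums_le[OF _ sums_zero cinner_diag_sums[OF bounded_G_weight]])
      (simp add: lam_nonneg)
  ultimately show "cinner (G x) (the (sqrt_L (G x))) \<in> \<real>\<^sub>\<ge>\<^sub>0"
    by (simp add: complex_nonneg_Reals_iff G_selfadjoint)
qed

lemma sqrt_L_squared: "sqrt_L \<circ>\<^sub>m sqrt_L = L"
proof -
  have "(sqrt_L \<circ>\<^sub>m sqrt_L) u = Some w \<longleftrightarrow> L u = Some w" for u w
  proof -
    have "(sqrt_L \<circ>\<^sub>m sqrt_L) u = Some w \<longleftrightarrow> u = G (G w)"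
      by (auto simp: map_comp_def sqrt_L_eq_Some_iff G_eq_iff split: option.splits)
    also have "\<dots> \<longleftrightarrow> (\<forall>j. proj j u = proj j (G (G w)))"
      using proj_ext by blast
    also have "\<dots> \<longleftrightarrow> (\<forall>j. proj j w = lam j *\<^sub>R proj j u)"
    proof (intro iff_allI)
      fix j
      show "proj j u = proj j (G (G w)) \<longleftrightarrow> proj j w = lam j *\<^sub>R proj j u"
        using lam_pos[of j] by (cases "j = 0") (auto simp: proj_G proj_0)
    qed
    finally show ?thesis
      by (simp add: L_eq_Some_iff)
  qed
  then show ?thesis
    by (intro ext) (metis option.exhaust)
qed

text \<open>A positive square root preserves the eigenspaces of \<open>L\<close> and acts on each of them as
  \<open>\<surd>\<lambda>\<^sub>j\<close>, as \<open>-\<surd>\<lambda>\<^sub>j\<close> is excluded by positivity. Hence it is a restriction of \<open>sqrt_L\<close>, and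
  self-adjoint operators have no proper self-adjoint restrictions.\<close>

lemma sqrt_L_unique:
  assumes S: "selfadjoint_op S" "positive_op S" "S \<circ>\<^sub>m S = L"
  shows "S = sqrt_L"
proof -
  have lin: "linear_op S"
    using S(1) by (simp add: selfadjoint_op_def)
  have L_iff: "L u = Some w \<longleftrightarrow> (\<exists>v. S u = Some v \<and> S v = Some w)" for u w
    by (auto simp: S(3)[symmetric] map_comp_def split: option.splits)
  have eigen: "S e = Some (sqrt (lam j) *\<^sub>R e)"
    if e: "e \<in> eigenspace L (complex_of_real (lam j))" for e j
  proof (cases "e = 0")
    case True
    then show ?thesis
      using linear_op_0[OF lin] by simp
  next
    case False
    then have "lam j > 0"
      using e proj_same[OF e] proj_0[of e] lam_pos[of j] by (cases "j = 0") auto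
    define s where "s = complex_of_real (sqrt (lam j))"
    have s2: "s * s = complex_of_real (lam j)"
      using \<open>lam j > 0\<close> by (simp add: s_def flip: of_real_mult)
    obtain v where v: "S e = Some v" "S v = Some (complex_of_real (lam j) *\<^sub>C e)"
      using e by (auto simp: mem_eigenspace_iff L_iff)
    \<comment> \<open>The vector \<open>d\<close> satisfies \<open>S d = - s d\<close>, so positivity forces \<open>d = 0\<close>.\<close>
    define d where "d = v - s *\<^sub>C e"
    have dom: "e \<in> dom S" "v \<in> dom S"
      using v by auto
    have "S d = Some (complex_of_real (lam j) *\<^sub>C e - s *\<^sub>C v)"
      using linear_op_diff[OF lin dom(2), of "s *\<^sub>C e"] linear_op_scaleC[OF lin dom(1), of s] v
      by (auto simp: d_def)
    also have "complex_of_real (lam j) *\<^sub>C e - s *\<^sub>C v = - (s *\<^sub>C d)"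
      by (simp add: d_def s2[symmetric] complex_vector.scale_right_diff_distrib scaleC_scaleC)
    finally have Sd: "S d = Some (- (s *\<^sub>C d))" .
    then have "cinner d (- (s *\<^sub>C d)) \<in> \<real>\<^sub>\<ge>\<^sub>0"
      using S(2) unfolding positive_op_def by (metis domI option.sel)
    then have "sqrt (lam j) * (norm d)\<^sup>2 \<le> 0"
      by (simp add: complex_nonneg_Reals_iff cinner_linear cinner_self s_def)
    then have "d = 0"
      using \<open>lam j > 0\<close> by (simp add: mult_le_0_iff)
    then show ?thesis
      using v(1) by (simp add: d_def s_def scaleC_of_real)
  qed
  have restrict: "sqrt_L u = Some v" if u: "S u = Some v" for u v
  proof -
    have "proj j v = sqrt (lam j) *\<^sub>R proj j u" for j
    proof (rule proj_eqI)
      show "sqrt (lam j) *\<^sub>R proj j u \<in> eigenspace L (complex_of_real (lam j))"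
        using complex_vector.subspace_scale[OF csubspace_E proj_in] by (simp flip: scaleC_of_real)
      show "cinner e (sqrt (lam j) *\<^sub>R proj j u) = cinner e v"
        if e: "e \<in> eigenspace L (complex_of_real (lam j))" for e
        using selfadjoint_op_symmetric[OF S(1), of e u] eigen[OF e] u
        by (auto simp: cinner_linear cinner_proj_right[OF e])
    qed
    then have "proj j u = proj j (G v)" for j
      using lam_pos[of j] by (cases "j = 0") (simp_all add: proj_G proj_0)
    then show ?thesis
      using proj_ext by (auto simp: sqrt_L_eq_Some_iff)
  qed
  have "S x = Some y" if y: "sqrt_L x = Some y" for x y
  proof -
    have "cinner (the (S u)) x = cinner u y" if "u \<in> dom S" for u
      using that selfadjoint_op_symmetric[OF selfadjoint_sqrt_L, of u x] y restrict[of u]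
      by (auto simp: domIff)
    then show ?thesis
      by (simp add: selfadjoint_op_eq_Some_iff[OF S(1)])
  qed
  then show ?thesis
    using restrict by (intro ext) (metis option.exhaust)
qed

lemma op_sqrt_eq: "op_sqrt L = sqrt_L"
  unfolding op_sqrt_def
proof (rule the_equality)
  show "selfadjoint_op sqrt_L \<and> positive_op sqrt_L \<and> sqrt_L \<circ>\<^sub>m sqrt_L = L"
    using selfadjoint_sqrt_L positive_sqrt_L sqrt_L_squared by blast
qed (use sqrt_L_unique in blast)

lemma H1_eq: "H1 L = range G"
  by (simp add: H1_def op_sqrt_eq dom_sqrt_L)

lemma norm_H1_G [simp]: "norm_H1 L (G x) = norm x"
  by (simp add: norm_H1_def op_sqrt_eq)

lemma L_ext_G: "L_ext L (G x) (G y) = cinner y x"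
  by (simp add: L_ext_def op_sqrt_eq H1_eq)

lemma embed_Hm1_G: "embed_Hm1 L f (G x) = cinner x (G f)"
  by (simp add: embed_Hm1_def H1_eq G_selfadjoint)

end


section \<open>Lower bounds for the stationary operator\<close>

text \<open>If \<open>X > H\<close>, every occurrence of \<open>H\<^sup>2\<close> may be replaced by \<open>H X\<close>, and the resulting
  inequality is divided by \<open>X\<close>; if \<open>X \<le> H\<close>, it suffices that the factor is at least \<open>1\<close>.\<close>

lemma absorb_quadratic_inequality:
  fixes X Y N H a b m w :: real
  assumes w: "w > 0" and a: "a \<ge> 1" and m: "m \<ge> 0" and b: "b \<ge> 0"
    and X: "X \<ge> 0" and H: "H \<ge> 0"
    and N: "w * N \<le> H * X"
    and Y: "Y\<^sup>2 \<le> 2 * a\<^sup>2 * (H\<^sup>2 + b * w * (H * X))"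
    and XY: "X\<^sup>2 \<le> 2 * m * N + (1 + 2 * m * b) * Y\<^sup>2"
  shows "X \<le> (m / w + (1 + m) * a\<^sup>2 * (1 + w)) * (16 * (1 + b)\<^sup>2) * H"
proof -
  define q where "q = (1 + m) * a\<^sup>2 * (1 + w)"
  have "1 * 1 * 1 \<le> q"
    unfolding q_def using w m a by (intro mult_mono) auto
  then have q: "q \<ge> 1"
    by simp
  have b1: "(1 + b)\<^sup>2 \<ge> 1"
    using b by simp
  have mw: "m / w \<ge> 0"
    using m w by simp
  have "X \<le> (m / w + q) * (16 * (1 + b)\<^sup>2) * H"
  proof (cases "X \<le> H")
    case True
    have "1 * 1 \<le> (m / w + q) * (16 * (1 + b)\<^sup>2)"
      using q b1 mw by (intro mult_mono) auto
    then have "1 * H \<le> (m / w + q) * (16 * (1 + b)\<^sup>2) * H"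
      using H by (intro mult_right_mono) auto
    then show ?thesis
      using True by linarith
  next
    case False
    have "2 * m * N \<le> 2 * (m / w) * (H * X)"
      using mult_left_mono[OF N, of "2 * m / w"] w m by (simp add: mult_ac)
    moreover have "(1 + 2 * m * b) * Y\<^sup>2 \<le> 4 * (1 + b)\<^sup>2 * q * (H * X)"
    proof -
      have "H\<^sup>2 \<le> H * X"
        using False H by (simp add: power2_eq_square mult_left_mono)
      then have "H\<^sup>2 + b * w * (H * X) \<le> (1 + b * w) * (H * X)"
        by (simp add: algebra_simps)
      also have "\<dots> \<le> ((1 + b) * (1 + w)) * (H * X)"
        using b w H X by (intro mult_right_mono) (auto simp: algebra_simps)
      finally have "Y\<^sup>2 \<le> 2 * a\<^sup>2 * (((1 + b) * (1 + w)) * (H * X))"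
        using Y by (meson mult_left_mono order_trans zero_le_mult_iff zero_le_power2 zero_le_numeral)
      then have "(1 + 2 * m * b) * Y\<^sup>2
          \<le> (2 * (1 + b) * (1 + m)) * (2 * a\<^sup>2 * (((1 + b) * (1 + w)) * (H * X)))"
        using m b by (intro mult_mono) (auto simp: algebra_simps)
      also have "\<dots> = 4 * (1 + b)\<^sup>2 * q * (H * X)"
        unfolding q_def by algebra
      finally show ?thesis .
    qed
    ultimately have "X\<^sup>2 \<le> (2 * (m / w) + 4 * (1 + b)\<^sup>2 * q) * H * X"
      using XY by (simp add: algebra_simps)
    then have "X \<le> (2 * (m / w) + 4 * (1 + b)\<^sup>2 * q) * H"
      using False H by (simp add: power2_eq_square)
    also have "\<dots> \<le> ((16 * (1 + b)\<^sup>2) * (m / w) + (16 * (1 + b)\<^sup>2) * q) * H"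
      using mw b1 q H by (intro mult_right_mono add_mono) auto
    finally show ?thesis
      by (simp add: algebra_simps)
  qed
  then show ?thesis
    unfolding q_def .
qed

text \<open>\<open>D\<close> plays the role of \<open>L\<^sup>-\<^sup>1\<^sup>/\<^sup>2 B L\<^sup>-\<^sup>1\<^sup>/\<^sup>2\<close>: the damping, conjugated to a bounded operator
  on \<open>H\<^sub>0\<close>.\<close>

locale damped_wave = discrete_spectrum L lam
  for L :: "'h::{complex_inner, complete_space} \<rightharpoonup> 'h" and lam +
  fixes D :: "'h \<Rightarrow> 'h" and b :: real
  assumes D_add: "D (x + y) = D x + D y"
    and D_scaleC: "D (c *\<^sub>C x) = c *\<^sub>C D x"
    and D_selfadjoint: "cinner (D x) y = cinner x (D y)"
    and D_nonneg: "inner x (D x) \<ge> 0"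
    and b_nonneg: "b \<ge> 0"
    and D_bound: "norm (D x) \<le> b * norm x"
begin

lemma D_scaleR: "D (r *\<^sub>R x) = r *\<^sub>R D x"
  using D_scaleC[of "of_real r" x] by (simp add: scaleC_of_real)

lemma D_diff: "D (x - y) = D x - D y"
  using D_add[of x "(-1) *\<^sub>C y"] D_scaleC[of "-1" y] by simp

lemma linear_D: "linear D"
  by (intro linearI D_add D_scaleR)

lemma inner_D_le: "inner x (D x) \<le> b * (norm x)\<^sup>2"
proof -
  have "inner x (D x) \<le> norm x * (b * norm x)"
    using norm_cauchy_schwarz[of x "D x"] D_bound[of x] by (meson mult_left_mono norm_ge_zero order_trans)
  then show ?thesis
    by (simp add: power2_eq_square algebra_simps)
qed

lemma inner_D_scaleC: "inner (c *\<^sub>C x) (D (c *\<^sub>C x)) = (cmod c)\<^sup>2 * inner x (D x)"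
  by (simp add: D_scaleC inner_eq_Re_cinner cinner_linear complex_norm_square[symmetric]
      flip: mult.assoc of_real_power)

lemma inner_D_real_square_le: "(inner y (D x))\<^sup>2 \<le> inner y (D y) * inner x (D x)"
  by (rule form_cauchy_schwarz[OF linear_D _ D_nonneg])
    (simp add: inner_eq_Re_cinner D_selfadjoint)

text \<open>The complex form of the Cauchy-Schwarz inequality for \<open>D\<close> follows by rotating \<open>x\<close> so that the scalar
  product becomes real.\<close>

lemma cmod_cinner_D_square_le: "(cmod (cinner y (D x)))\<^sup>2 \<le> inner y (D y) * inner x (D x)"
proof (cases "cinner y (D x) = 0")
  case False
  define c where "c = cnj (cinner y (D x)) / cmod (cinner y (D x))"
  have "cmod c = 1"
    using False by (simp add: c_def norm_divide)
  have "c * cinner y (D x) = of_real (cmod (cinner y (D x)))"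
    using False by (simp add: c_def complex_norm_square[symmetric] power2_eq_square mult.commute)
  then have "cmod (cinner y (D x)) = inner y (D (c *\<^sub>C x))"
    by (simp add: inner_eq_Re_cinner cinner_linear D_scaleC)
  then show ?thesis
    using inner_D_real_square_le[of y "c *\<^sub>C x"] \<open>cmod c = 1\<close> by (simp add: inner_D_scaleC)
qed (simp add: D_nonneg)

lemma inner_D_diff_le: "inner (x - y) (D (x - y)) \<le> 2 * (inner x (D x) + inner y (D y))"
proof -
  have "inner (x - y) (D (x - y)) + inner (x + y) (D (x + y)) = 2 * (inner x (D x) + inner y (D y))"
    by (simp add: D_diff D_add inner_diff_left inner_diff_right inner_add_left inner_add_right)
  then show ?thesis
    using D_nonneg[of "x + y"] by linarith
qed

text \<open>\<open>T \<omega>\<close> is the stationary operator \<open>L - \<i> \<omega> B - \<omega>\<^sup>2\<close> from \<open>H\<^sub>1\<close> to \<open>H\<^sub>-\<^sub>1\<close>, multiplied by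
  \<open>L\<^sup>-\<^sup>1\<^sup>/\<^sup>2\<close> on both sides.\<close>

definition T :: "real \<Rightarrow> 'h \<Rightarrow> 'h" where
  "T \<omega> x = x - (\<i> * of_real \<omega>) *\<^sub>C D x - \<omega>\<^sup>2 *\<^sub>R G (G x)"

lemma T_adjoint: "cinner (T \<omega> x) y = cinner x (T (- \<omega>) y)"
  by (simp add: T_def cinner_linear D_selfadjoint G_selfadjoint)

lemma cinner_T:
  "cinner x (T \<omega> x) = of_real ((norm x)\<^sup>2 - \<omega>\<^sup>2 * (norm (G x))\<^sup>2) - \<i> * of_real (\<omega> * inner x (D x))"
proof -
  have "cinner x (D x) = cnj (cinner x (D x))"
    using cinner_commute[of x "D x"] by (simp add: D_selfadjoint)
  from arg_cong[OF this, of Im] have "cinner x (D x) = of_real (inner x (D x))"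
    by (simp add: inner_eq_Re_cinner complex_eq_iff)
  moreover have "cinner x (G (G x)) = of_real ((norm (G x))\<^sup>2)"
    by (simp add: cinner_self flip: G_selfadjoint)
  ultimately show ?thesis
    by (simp add: T_def cinner_linear cinner_self algebra_simps)
qed

text \<open>The imaginary part of the quadratic form of \<open>T \<omega>\<close> is \<open>- \<omega> (x, D x)\<close>, and its real part
  compares \<open>\<omega>\<^sup>2 \<parallel>G x\<parallel>\<^sup>2\<close> with \<open>\<parallel>x\<parallel>\<^sup>2\<close>.\<close>

lemma damping_le: "\<bar>\<omega>\<bar> * inner x (D x) \<le> norm (T \<omega> x) * norm x"
proof -
  have "\<bar>\<omega>\<bar> * inner x (D x) = \<bar>Im (cinner x (T \<omega> x))\<bar>"
    using D_nonneg[of x] by (simp add: cinner_T abs_mult)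
  also have "\<dots> \<le> norm x * norm (T \<omega> x)"
    using abs_Im_le_cmod cmod_cinner_le order_trans by blast
  finally show ?thesis
    by (simp add: mult.commute)
qed

lemma energy_le: "\<omega>\<^sup>2 * (norm (G x))\<^sup>2 \<le> (norm x)\<^sup>2 + norm x * norm (T \<omega> x)"
proof -
  have "\<omega>\<^sup>2 * (norm (G x))\<^sup>2 = (norm x)\<^sup>2 - Re (cinner x (T \<omega> x))"
    by (simp add: cinner_T)
  then show ?thesis
    using abs_Re_le_cmod[of "cinner x (T \<omega> x)"] cmod_cinner_le[of x "T \<omega> x"] by linarith
qed

lemma proj_G_G: "proj j (G (G x)) = (1 / lam j) *\<^sub>R proj j x"
  using lam_nonneg[of j] by (simp add: proj_G flip: real_sqrt_mult)

context
  fixes k :: nat and \<omega> :: real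
  assumes k: "k \<ge> 1" and below: "lam (k - 1) < \<omega>\<^sup>2" and above: "\<omega>\<^sup>2 < lam (k + 1)"
begin

lemma alpha_above_ge_1: "alpha lam (k + 1) \<omega> \<ge> 1"
  using above by (simp add: alpha_def abs_of_neg)

lemma alpha_below_nonneg: "alpha lam (k - 1) \<omega> \<ge> 0"
  using lam_nonneg by (simp add: alpha_def)

text \<open>The quotient \<open>\<omega>\<^sup>2 / \<lambda>\<^sub>j\<close> decreases in \<open>j\<close>, so the worst cases are the two neighbours of
  \<open>k\<close>, where the signed weight is the reciprocal of \<open>\<alpha>\<^sub>j\<close>.\<close>

lemma nonresonant_weight:
  assumes j: "j \<ge> 1" "j \<noteq> k"
  defines "a \<equiv> alpha lam (k - 1) \<omega> + alpha lam (k + 1) \<omega>"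
  shows "1 / a \<le> (if j < k then -1 else 1) * (1 - \<omega>\<^sup>2 / lam j)"
proof (cases "j < k")
  case True
  then have pos: "lam (k - 1) > 0" "lam j > 0" and le: "lam j \<le> lam (k - 1)"
    using j lam_pos lam_mono by (auto simp: strict_mono_less_eq)
  have "alpha lam (k - 1) \<omega> > 0"
    using below pos(1) by (simp add: alpha_def)
  then have "1 / a \<le> 1 / alpha lam (k - 1) \<omega>"
    using alpha_above_ge_1 by (intro frac_le) (auto simp: a_def)
  also have "\<dots> = \<omega>\<^sup>2 / lam (k - 1) - 1"
    using below pos(1) by (simp add: alpha_def field_simps)
  also have "\<dots> \<le> \<omega>\<^sup>2 / lam j - 1"
    using pos le by (intro diff_right_mono divide_left_mono) auto
  finally show ?thesis
    using True by simp
next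
  case False
  then have pos: "lam (k + 1) > 0" "lam j > 0" and le: "lam (k + 1) \<le> lam j"
    using j lam_pos lam_mono by (auto simp: strict_mono_less_eq)
  have "1 / a \<le> 1 / alpha lam (k + 1) \<omega>"
    using alpha_above_ge_1 alpha_below_nonneg by (intro frac_le) (auto simp: a_def)
  also have "\<dots> = 1 - \<omega>\<^sup>2 / lam (k + 1)"
    using above pos(1) by (simp add: alpha_def field_simps abs_of_neg)
  also have "\<dots> \<le> 1 - \<omega>\<^sup>2 / lam j"
    using pos le by (intro diff_left_mono divide_left_mono) auto
  finally show ?thesis
    using False by simp
qed

text \<open>The equation is tested with \<open>y\<close>, the components of \<open>x\<close> other than the \<open>k\<close>-th, with the sign
  reversed below \<open>k\<close>. The undamped part is then coercive with constant \<open>1 / a\<close>. The damping term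
  is not small, but by Cauchy-Schwarz it involves \<open>x\<close> only through \<open>(x, D x)\<close>, which
  \<open>damping_le\<close> controls.\<close>

lemma nonresonant_part_le:
  fixes x
  defines "a \<equiv> alpha lam (k - 1) \<omega> + alpha lam (k + 1) \<omega>"
  shows "(norm (x - proj k x))\<^sup>2
    \<le> 2 * a\<^sup>2 * ((norm (T \<omega> x))\<^sup>2 + b * \<bar>\<omega>\<bar> * (norm (T \<omega> x) * norm x))"
proof -
  define eps where "eps j = (if j < k then -1 else if j > k then 1 else 0 :: real)" for j
  define y where "y = diag eps x"
  define N where "N = inner x (D x)"
  define z where "z = x - \<omega>\<^sup>2 *\<^sub>R G (G x)"
  have eps: "bounded (range eps)"
    by (rule finite_imp_bounded, rule finite_subset[of _ "{-1, 0, 1}"]) (auto simp: eps_def)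
  have a: "a \<ge> 1"
    using alpha_above_ge_1 alpha_below_nonneg by (simp add: a_def)
  have norm_y: "norm (x - proj k x) = norm y"
  proof -
    have "(norm (proj j (x - proj k x)))\<^sup>2 = (norm (proj j y))\<^sup>2" for j
      by (cases "j = k") (auto simp: y_def proj_diag[OF eps] proj_diff proj_same[OF proj_in]
          proj_other[OF proj_in] eps_def)
    then have "(norm (x - proj k x))\<^sup>2 = (norm y)\<^sup>2"
      using sums_unique2[OF norm_sums[of "x - proj k x"]] norm_sums[of y] by simp
    then show ?thesis
      by (simp add: power2_eq_iff_nonneg)
  qed
  have "(1 / a) * (norm y)\<^sup>2 \<le> inner y z"
  proof (rule sums_le)
    show "(\<lambda>j. (1 / a) * (norm (proj j y))\<^sup>2) sums ((1 / a) * (norm y)\<^sup>2)"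
      by (intro sums_mult norm_sums)
    show "(\<lambda>j. Re (cinner (proj j y) (proj j z))) sums inner y z"
      using sums_Re[OF cinner_sums[of y z]] by (simp add: inner_eq_Re_cinner)
    fix j
    show "(1 / a) * (norm (proj j y))\<^sup>2 \<le> Re (cinner (proj j y) (proj j z))"
    \<comment> \<open>The component with index \<open>0\<close> vanishes because \<open>\<lambda>\<^sub>0 = 0\<close> is not an eigenvalue.\<close>
    proof (cases "j = 0 \<or> j = k")
      case True
      then have "proj j y = 0"
        by (auto simp: proj_0 y_def proj_diag[OF eps] eps_def)
      then show ?thesis
        by simp
    next
      case False
      then have w: "1 / a \<le> eps j * (1 - \<omega>\<^sup>2 / lam j)"
        using nonresonant_weight[of j] by (auto simp: a_def eps_def)
      have "proj j z = (1 - \<omega>\<^sup>2 / lam j) *\<^sub>R proj j x"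
        by (simp add: z_def proj_diff proj_scaleR proj_G_G algebra_simps)
      then have "Re (cinner (proj j y) (proj j z))
          = eps j * (1 - \<omega>\<^sup>2 / lam j) * (norm (proj j x))\<^sup>2"
        by (simp add: y_def proj_diag[OF eps] cinner_linear cinner_self)
      moreover have "(norm (proj j y))\<^sup>2 = (norm (proj j x))\<^sup>2"
        using False by (simp add: y_def proj_diag[OF eps] eps_def)
      ultimately show ?thesis
        using mult_right_mono[OF w, of "(norm (proj j x))\<^sup>2"] by simp
    qed
  qed
  also have "inner y z = Re (cinner y (T \<omega> x)) + Re (\<i> * of_real \<omega> * cinner y (D x))"
    by (simp add: z_def T_def inner_eq_Re_cinner cinner_linear)
  also have "\<dots> \<le> norm y * norm (T \<omega> x) + \<bar>\<omega>\<bar> * cmod (cinner y (D x))"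
    using complex_Re_le_cmod[of "cinner y (T \<omega> x)"] cmod_cinner_le[of y "T \<omega> x"]
      complex_Re_le_cmod[of "\<i> * of_real \<omega> * cinner y (D x)"] by (simp add: norm_mult)
  also have "\<dots> \<le> norm y * norm (T \<omega> x) + \<bar>\<omega>\<bar> * (norm y * sqrt (b * N))"
  proof -
    have "(cmod (cinner y (D x)))\<^sup>2 \<le> inner y (D y) * N"
      unfolding N_def by (rule cmod_cinner_D_square_le)
    also have "\<dots> \<le> b * (norm y)\<^sup>2 * N"
      unfolding N_def by (intro mult_right_mono inner_D_le D_nonneg)
    finally have "cmod (cinner y (D x)) \<le> sqrt (b * (norm y)\<^sup>2 * N)"
      by (rule real_le_rsqrt)
    then have "cmod (cinner y (D x)) \<le> norm y * sqrt (b * N)"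
      by (simp add: real_sqrt_mult mult_ac)
    then show ?thesis
      by (simp add: mult_left_mono)
  qed
  finally have "norm y * norm y \<le> norm y * (a * (norm (T \<omega> x) + \<bar>\<omega>\<bar> * sqrt (b * N)))"
    using a by (simp add: field_simps power2_eq_square)
  moreover have "N \<ge> 0"
    unfolding N_def by (rule D_nonneg)
  ultimately have "norm y \<le> a * (norm (T \<omega> x) + \<bar>\<omega>\<bar> * sqrt (b * N))"
    using a b_nonneg by (cases "norm y = 0") (auto simp: mult_le_cancel_left_pos)
  then have "(norm y)\<^sup>2 \<le> (a * (norm (T \<omega> x) + \<bar>\<omega>\<bar> * sqrt (b * N)))\<^sup>2"
    by (rule power_mono) simp
  also have "\<dots> \<le> a\<^sup>2 * (2 * ((norm (T \<omega> x))\<^sup>2 + (\<bar>\<omega>\<bar> * sqrt (b * N))\<^sup>2))"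
    unfolding power_mult_distrib[of a]
    using sum_squares_bound[of "norm (T \<omega> x)" "\<bar>\<omega>\<bar> * sqrt (b * N)"]
    by (intro mult_left_mono) (simp_all add: power2_sum)
  also have "(\<bar>\<omega>\<bar> * sqrt (b * N))\<^sup>2 = b * \<bar>\<omega>\<bar> * (\<bar>\<omega>\<bar> * N)"
    using b_nonneg \<open>N \<ge> 0\<close> by (simp add: power_mult_distrib power2_eq_square mult_ac)
  also have "\<dots> \<le> b * \<bar>\<omega>\<bar> * (norm (T \<omega> x) * norm x)"
    unfolding N_def using b_nonneg by (intro mult_left_mono damping_le) auto
  finally show ?thesis
    unfolding norm_y using a by (simp add: algebra_simps)
qed

text \<open>On the \<open>k\<close>-th eigenspace the undamped part may vanish, and only the coercivity of the damping
  helps: it bounds \<open>proj k x\<close> by the damping of \<open>x\<close> and the damping of the remaining components,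
  both of which are already controlled.\<close>

lemma T_bounded_below:
  assumes m: "m \<ge> 0"
    and coercive: "\<And>e. e \<in> eigenspace L (complex_of_real (lam k)) \<Longrightarrow>
      (norm e)\<^sup>2 \<le> m * inner e (D e)"
  defines "a \<equiv> alpha lam (k - 1) \<omega> + alpha lam (k + 1) \<omega>"
  shows "norm x
    \<le> (m / \<bar>\<omega>\<bar> + (1 + m) * a\<^sup>2 * (1 + \<bar>\<omega>\<bar>)) * (16 * (1 + b)\<^sup>2) * norm (T \<omega> x)"
proof -
  have "\<bar>\<omega>\<bar> > 0"
    using below lam_nonneg[of "k - 1"] by auto
  have "a \<ge> 1"
    using alpha_above_ge_1 alpha_below_nonneg by (simp add: a_def)
  define y where "y = x - proj k x"
  have "(norm x)\<^sup>2 = (norm (proj k x))\<^sup>2 + (norm y)\<^sup>2"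
  proof -
    have "cinner (proj k x) y = 0"
      by (simp add: y_def cinner_diff_right cinner_proj_right)
    then have "inner (proj k x) y = 0"
      by (simp add: inner_eq_Re_cinner)
    then show ?thesis
      using norm_add_Pythagorean[of "proj k x" y] by (simp add: y_def orthogonal_def)
  qed
  also have "(norm (proj k x))\<^sup>2 \<le> m * inner (proj k x) (D (proj k x))"
    by (rule coercive) simp
  also have "\<dots> \<le> m * (2 * (inner x (D x) + inner y (D y)))"
    using inner_D_diff_le[of x y] m by (intro mult_left_mono) (simp_all add: y_def)
  also have "\<dots> \<le> m * (2 * (inner x (D x) + b * (norm y)\<^sup>2))"
    using inner_D_le[of y] m by (intro mult_left_mono) simp_all
  finally have "(norm x)\<^sup>2 \<le> 2 * m * inner x (D x) + (1 + 2 * m * b) * (norm y)\<^sup>2"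
    by (simp add: algebra_simps)
  with \<open>\<bar>\<omega>\<bar> > 0\<close> \<open>a \<ge> 1\<close> m b_nonneg norm_ge_zero[of x] norm_ge_zero[of "T \<omega> x"]
    damping_le[of \<omega> x] nonresonant_part_le[of x, folded a_def y_def]
  show ?thesis
    by (rule absorb_quadratic_inequality)
qed

end

lemma T_add: "T \<omega> (x + y) = T \<omega> x + T \<omega> y"
  by (simp add: T_def D_add G_add scaleC_add_right scaleR_add_right)

lemma T_diff: "T \<omega> (x - y) = T \<omega> x - T \<omega> y"
  by (simp add: T_def D_diff G_diff complex_vector.scale_right_diff_distrib scaleR_diff_right)

lemma T_scaleC: "T \<omega> (c *\<^sub>C x) = c *\<^sub>C T \<omega> x"
  by (simp add: T_def D_scaleC G_scaleC complex_vector.scale_right_diff_distrib scaleC_scaleC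
      mult_ac flip: scaleC_of_real)

lemma T_scaleR: "T \<omega> (r *\<^sub>R x) = r *\<^sub>R T \<omega> x"
  using T_scaleC[of \<omega> "of_real r" x] by (simp add: scaleC_of_real)

lemma norm_G_G_le: "norm (G (G x)) \<le> (1 / lam 1) * norm x"
proof -
  have "norm (G (G x)) \<le> (1 / sqrt (lam 1)) * ((1 / sqrt (lam 1)) * norm x)"
    using norm_G_le[of "G x"] norm_G_le[of x] lam_nonneg[of 1]
    by (meson mult_left_mono order_trans divide_nonneg_nonneg real_sqrt_ge_zero zero_le_one)
  then show ?thesis
    using lam_nonneg[of 1] by simp
qed

lemma bounded_linear_T: "bounded_linear (T \<omega>)"
proof
  show "\<exists>K. \<forall>x. norm (T \<omega> x) \<le> norm x * K"
  proof (intro exI allI)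
    fix x
    have "norm (T \<omega> x) \<le> norm x + \<bar>\<omega>\<bar> * norm (D x) + \<omega>\<^sup>2 * norm (G (G x))"
      unfolding T_def
      by (rule order_trans[OF norm_triangle_ineq4 add_mono[OF order_trans[OF norm_triangle_ineq4]]])
        (simp_all add: norm_mult)
    also have "\<dots> \<le> norm x + \<bar>\<omega>\<bar> * (b * norm x) + \<omega>\<^sup>2 * ((1 / lam 1) * norm x)"
      using D_bound[of x] norm_G_G_le[of x] by (intro add_mono mult_left_mono) auto
    finally show "norm (T \<omega> x) \<le> norm x * (1 + \<bar>\<omega>\<bar> * b + \<omega>\<^sup>2 * (1 / lam 1))"
      by (simp add: algebra_simps)
  qed
qed (simp_all add: T_add T_scaleR)

text \<open>\<open>T \<omega>\<close> is injective with closed range if it is bounded below, and its range is dense if its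
  adjoint \<open>T (- \<omega>)\<close> is injective.\<close>

lemma T_surj:
  assumes C: "\<And>x. norm x \<le> C * norm (T \<omega> x)" and C': "\<And>x. norm x \<le> C' * norm (T (- \<omega>) x)"
  shows "\<exists>x. T \<omega> x = h"
proof -
  have "subspace (range (T \<omega>))"
  proof (rule subspaceI)
    show "0 \<in> range (T \<omega>)"
      using T_diff[of \<omega> 0 0] by (metis diff_self rangeI)
  qed (auto simp flip: T_add T_scaleR)
  then have "closure (range (T \<omega>)) = UNIV"
  proof (rule dense_subspaceI)
    fix w assume "\<And>v. v \<in> range (T \<omega>) \<Longrightarrow> inner v w = 0"
    then have "inner (T \<omega> (T (- \<omega>) w)) w = 0"
      by blast
    then have "T (- \<omega>) w = 0"
      by (simp add: inner_eq_Re_cinner T_adjoint cinner_self)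
    then show "w = 0"
      using C'[of w] by simp
  qed
  then obtain f where f: "\<And>n. f n \<in> range (T \<omega>)" "f \<longlonglongrightarrow> h"
    using closure_sequential[of h "range (T \<omega>)"] by auto
  then obtain x where x: "\<And>n. f n = T \<omega> (x n)"
    unfolding image_iff by metis
  define K where "K = \<bar>C\<bar> + 1"
  have K: "K > 0" "norm x \<le> K * norm (T \<omega> x)" for x
  proof -
    have "C * norm (T \<omega> x) \<le> K * norm (T \<omega> x)"
      by (intro mult_right_mono) (auto simp: K_def)
    then show "norm x \<le> K * norm (T \<omega> x)"
      using C[of x] by linarith
  qed (simp add: K_def)
  have "Cauchy x"
  proof (rule metric_CauchyI)
    fix e :: real assume "e > 0"
    then obtain N where N: "\<And>m n. m \<ge> N \<Longrightarrow> n \<ge> N \<Longrightarrow> dist (f m) (f n) < e / K"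
      using LIMSEQ_imp_Cauchy[OF f(2)] K(1) by (meson metric_CauchyD divide_pos_pos)
    have "dist (x m) (x n) < e" if "m \<ge> N" "n \<ge> N" for m n
    proof -
      have "dist (x m) (x n) \<le> K * dist (f m) (f n)"
        using K(2)[of "x m - x n"] by (simp add: dist_norm x T_diff)
      also have "\<dots> < e"
        using N[OF that] K(1) by (simp add: field_simps)
      finally show ?thesis .
    qed
    then show "\<exists>N. \<forall>m\<ge>N. \<forall>n\<ge>N. dist (x m) (x n) < e"
      by blast
  qed
  then obtain l where l: "x \<longlonglongrightarrow> l"
    using Cauchy_convergent convergent_def by blast
  have "f \<longlonglongrightarrow> T \<omega> l"
    using bounded_linear.tendsto[OF bounded_linear_T[of \<omega>] l] by (simp flip: x)
  then show ?thesis
    using LIMSEQ_unique[OF f(2)] by blast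
qed

end


section \<open>From the stationary operator to the resolvent\<close>

lemma bdd_above_opnorm_quotients:
  assumes f: "bounded_on X nX nY f" and nX: "\<And>x. x \<in> X \<Longrightarrow> 0 \<le> nX x"
  shows "bdd_above ((\<lambda>x. nY (f x) / nX x) ` X)"
proof -
  obtain K where K: "\<And>x. x \<in> X \<Longrightarrow> nY (f x) \<le> K * nX x"
    using f by (auto simp: bounded_on_def)
  have "nY (f y) / nX y \<le> \<bar>K\<bar>" if y: "y \<in> X" for y
  proof (cases "nX y = 0")
    case False
    then have "nY (f y) / nX y \<le> K"
      using K[OF y] nX[OF y] by (simp add: divide_le_eq)
    then show ?thesis
      by linarith
  qed simp
  then show ?thesis
    by (rule bdd_aboveI2)
qed

lemma le_opnorm:
  assumes f: "bounded_on X nX nY f" and nX: "\<And>x. x \<in> X \<Longrightarrow> 0 \<le> nX x" and x: "x \<in> X"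
  shows "nY (f x) \<le> opnorm X nX nY f * nX x"
proof (cases "nX x = 0")
  case True
  then show ?thesis
    using f x by (auto simp: bounded_on_def)
next
  case False
  have "nY (f x) / nX x \<le> opnorm X nX nY f"
    unfolding opnorm_def by (rule cSUP_upper[OF x bdd_above_opnorm_quotients[OF f nX]])
  then show ?thesis
    using False nX[OF x] by (simp add: divide_le_eq)
qed

lemma opnorm_nonneg:
  assumes f: "bounded_on X nX nY f" and nX: "\<And>x. x \<in> X \<Longrightarrow> 0 \<le> nX x"
    and x: "x \<in> X" "0 \<le> nY (f x)"
  shows "0 \<le> opnorm X nX nY f"
proof -
  have "0 \<le> nY (f x) / nX x"
    using x nX by simp
  also have "\<dots> \<le> opnorm X nX nY f"
    unfolding opnorm_def by (rule cSUP_upper[OF x(1) bdd_above_opnorm_quotients[OF f nX]])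
  finally show ?thesis .
qed

lemma opnorm_le:
  assumes "X \<noteq> {}" and nX: "\<And>x. x \<in> X \<Longrightarrow> 0 \<le> nX x" and C: "C \<ge> 0"
    and le: "\<And>x. x \<in> X \<Longrightarrow> nY (f x) \<le> C * nX x"
  shows "opnorm X nX nY f \<le> C"
  unfolding opnorm_def
proof (rule cSUP_least[OF \<open>X \<noteq> {}\<close>])
  fix x assume x: "x \<in> X"
  show "nY (f x) / nX x \<le> C"
    using le[OF x] nX[OF x] C by (cases "nX x = 0") (simp_all add: divide_le_eq)
qed

locale damped_wave_operator = damped_wave L lam D b
  for L :: "'h::{complex_inner, complete_space} \<rightharpoonup> 'h" and lam D b +
  fixes B :: "'h \<Rightarrow> 'h \<Rightarrow> complex"
  assumes B_G: "B (G x) (G y) = cinner y (D x)"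
    and B_outside: "\<phi> \<notin> H1 L \<Longrightarrow> B (G x) \<phi> = 0"
begin

lemma wave_equation_iff:
  "(\<lambda>\<phi>. L_ext L (G x) \<phi> + B (G y) \<phi>) = embed_Hm1 L f \<longleftrightarrow> x + D y = G f"
proof
  assume *: "(\<lambda>\<phi>. L_ext L (G x) \<phi> + B (G y) \<phi>) = embed_Hm1 L f"
  have "cinner z (x + D y) = cinner z (G f)" for z
    using fun_cong[OF *, of "G z"] by (simp add: L_ext_G B_G embed_Hm1_G cinner_linear)
  then show "x + D y = G f"
    by (rule cinner_eqI)
next
  assume *: "x + D y = G f"
  show "(\<lambda>\<phi>. L_ext L (G x) \<phi> + B (G y) \<phi>) = embed_Hm1 L f"
  proof
    fix \<phi>
    show "L_ext L (G x) \<phi> + B (G y) \<phi> = embed_Hm1 L f \<phi>"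
    proof (cases "\<phi> \<in> H1 L")
      case True
      then show ?thesis
        by (auto simp: H1_eq L_ext_G B_G embed_Hm1_G cinner_linear simp flip: *)
    qed (simp add: L_ext_def embed_Hm1_def B_outside)
  qed
qed

lemma wave_op_G:
  assumes "x + D y = G f"
  shows "wave_op L B (G x, G y) = Some (- G y, f)"
proof -
  have *: "x + D y = G h \<longleftrightarrow> h = f" for h
    using assms by (auto simp: G_eq_iff)
  show ?thesis
    by (simp add: wave_op_def H1_eq wave_equation_iff *)
qed

lemma dom_wave_op: "U \<in> dom (wave_op L B) \<longleftrightarrow> (\<exists>x y f. U = (G x, G y) \<and> x + D y = G f)"
proof
  assume "U \<in> dom (wave_op L B)"
  moreover obtain u v where uv: "U = (u, v)"
    by (cases U)
  ultimately have "u \<in> range G" "v \<in> range G"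
    "\<exists>f. (\<lambda>\<phi>. L_ext L u \<phi> + B v \<phi>) = embed_Hm1 L f"
    by (auto simp: wave_op_def H1_eq split: if_splits)
  then obtain x y f where "u = G x" "v = G y" "x + D y = G f"
    by (auto simp: wave_equation_iff)
  then show "\<exists>x y f. U = (G x, G y) \<and> x + D y = G f"
    using uv by blast
qed (auto dest: wave_op_G)

text \<open>This is \<open>A - \<i> \<omega>\<close> on the domain of \<open>A\<close>.\<close>

definition shifted :: "real \<Rightarrow> 'h \<times> 'h \<Rightarrow> 'h \<times> 'h" where
  "shifted \<omega> U = the (wave_op L B U) - (\<i> * of_real \<omega>) *\<^sub>C U"

lemma shifted_G:
  assumes "x + D y = G f"
  shows "shifted \<omega> (G x, G y)
    = (G (- y - (\<i> * of_real \<omega>) *\<^sub>C x), f - (\<i> * of_real \<omega>) *\<^sub>C G y)"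
proof -
  have "G (- y) = - G y"
    using G_scaleC[of "-1" y] by simp
  then show ?thesis
    by (simp add: shifted_def wave_op_G[OF assms] scaleC_prod_def G_diff G_scaleC)
qed

lemma shifted_range:
  assumes "U \<in> dom (wave_op L B)"
  shows "\<exists>a g. shifted \<omega> U = (G a, g)"
proof -
  obtain x y f where "U = (G x, G y)" "x + D y = G f"
    using assms by (auto simp: dom_wave_op)
  then show ?thesis
    using shifted_G[of x y f \<omega>] by blast
qed

lemma i_times_real_square:
  "(\<i> * complex_of_real \<omega>) * (\<i> * complex_of_real \<omega>) = - of_real (\<omega>\<^sup>2)"
  by (simp add: complex_eq_iff power2_eq_square)

text \<open>Eliminating the velocity \<open>y\<close> from the resolvent equation leaves the stationary
  equation for \<open>x\<close>.\<close>

lemma shifted_eq_iff: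
  "U \<in> dom (wave_op L B) \<and> shifted \<omega> U = (G a, g) \<longleftrightarrow>
    (\<exists>x. U = (G x, G (- a - (\<i> * of_real \<omega>) *\<^sub>C x)) \<and>
      T \<omega> x = G g + D a - (\<i> * of_real \<omega>) *\<^sub>C G (G a))"
proof -
  let ?w = "\<i> * complex_of_real \<omega>"
  have elim: "x + D (- a - ?w *\<^sub>C x) = G (g + ?w *\<^sub>C G (- a - ?w *\<^sub>C x)) \<longleftrightarrow>
      T \<omega> x = G g + D a - ?w *\<^sub>C G (G a)" for x
  proof -
    have G_minus: "G (- v) = - G v" for v
      using G_scaleC[of "-1" v] by simp
    have D_eq: "D (- a - ?w *\<^sub>C x) = - D a - ?w *\<^sub>C D x"
      using D_scaleC[of "-1" a] by (simp add: D_diff D_scaleC)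
    have "?w *\<^sub>C ?w *\<^sub>C G (G x) = - (\<omega>\<^sup>2 *\<^sub>R G (G x))"
      unfolding scaleC_scaleC i_times_real_square
      by (simp add: scaleC_of_real del: of_real_power)
    then have G_eq: "G (g + ?w *\<^sub>C G (- a - ?w *\<^sub>C x)) = G g - ?w *\<^sub>C G (G a) + \<omega>\<^sup>2 *\<^sub>R G (G x)"
      by (simp only: G_add G_scaleC G_diff G_minus complex_vector.scale_right_diff_distrib
          complex_vector.scale_minus_right) simp
    then show ?thesis
      unfolding T_def D_eq G_eq by (auto simp: algebra_simps)
  qed
  show ?thesis
  proof
    assume *: "U \<in> dom (wave_op L B) \<and> shifted \<omega> U = (G a, g)"
    then obtain x y f where U: "U = (G x, G y)" "x + D y = G f"
      by (auto simp: dom_wave_op)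
    have "y = - a - ?w *\<^sub>C x" "f = g + ?w *\<^sub>C G y"
      using * unfolding U(1) shifted_G[OF U(2)] by (auto simp: G_eq_iff)
    then show "\<exists>x. U = (G x, G (- a - ?w *\<^sub>C x)) \<and> T \<omega> x = G g + D a - ?w *\<^sub>C G (G a)"
      using U elim by auto
  next
    assume "\<exists>x. U = (G x, G (- a - ?w *\<^sub>C x)) \<and> T \<omega> x = G g + D a - ?w *\<^sub>C G (G a)"
    then obtain x where x: "U = (G x, G (- a - ?w *\<^sub>C x))"
      "x + D (- a - ?w *\<^sub>C x) = G (g + ?w *\<^sub>C G (- a - ?w *\<^sub>C x))"
      unfolding elim[symmetric] by blast
    then show "U \<in> dom (wave_op L B) \<and> shifted \<omega> U = (G a, g)"
      using shifted_G[OF x(2), of \<omega>] by (auto simp: dom_wave_op)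
  qed
qed

text \<open>The constant collects the estimates of the two parts of the solution in
  \<open>resolvent_estimate\<close>: \<open>2 + b + 1 / \<lambda>\<^sub>1\<close> belongs to the data \<open>a\<close>, and \<open>3 / \<surd>\<lambda>\<^sub>1\<close> to the data \<open>g\<close>.\<close>

definition transfer_const :: real where
  "transfer_const = (2 + b + 1 / lam 1) * (1 + 1 / sqrt (lam 1)) + 3 / sqrt (lam 1)"

lemma transfer_const_pos: "transfer_const > 0"
  using b_nonneg lam_pos[of 1] unfolding transfer_const_def
  by (intro add_pos_nonneg mult_pos_pos) (auto intro!: add_pos_nonneg add_nonneg_nonneg)

lemma norm_wave_G: "norm_wave L (G x, v) = sqrt ((norm x)\<^sup>2 + (norm v)\<^sup>2)"
  by (simp add: norm_wave_def)

text \<open>Using the lower bound for \<open>T \<omega>\<close> naively would lose a factor \<open>1 + |\<omega>|\<close>. The data \<open>g\<close> and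
  \<open>a\<close> are therefore treated separately. For \<open>g\<close> the energy inequality bounds \<open>|\<omega>| \<parallel>G x1\<parallel>\<close> without a
  loss. For \<open>a\<close> and \<open>|\<omega>| \<ge> 1\<close> the velocity \<open>y2\<close> is estimated first, since it solves the stationary
  equation \<open>T \<omega> y2 = - a\<close>, whose right-hand side does not grow with \<open>\<omega>\<close>; the displacement \<open>x2\<close>
  is then recovered by dividing by \<open>\<omega>\<close>. For \<open>|\<omega>| \<le> 1\<close> the equation for \<open>x2\<close> is used
  directly.\<close>

lemma resolvent_estimate:
  assumes C: "C \<ge> 1" and below: "\<And>x. norm x \<le> C * norm (T \<omega> x)"
    and surj: "\<And>h. \<exists>x. T \<omega> x = h"
    and x: "T \<omega> x = G g + D a - (\<i> * of_real \<omega>) *\<^sub>C G (G a)"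
    and y: "y = - a - (\<i> * of_real \<omega>) *\<^sub>C x"
  shows "norm_wave L (G x, G y) \<le> transfer_const * C * norm_wave L (G a, g)"
proof -
  let ?w = "\<i> * complex_of_real \<omega>"
  define \<gamma> where "\<gamma> = 1 / sqrt (lam 1)"
  define s where "s = 2 + b + 1 / lam 1"
  have \<gamma>: "\<gamma> \<ge> 0" "1 / lam 1 \<ge> 0" and G_le: "norm (G v) \<le> \<gamma> * norm v" for v
    using lam_nonneg[of 1] norm_G_le[of v] by (simp_all add: \<gamma>_def)
  obtain x1 where x1: "T \<omega> x1 = G g"
    using surj by blast
  define x2 where "x2 = x - x1"
  define y2 where "y2 = - a - ?w *\<^sub>C x2"
  have Tx2: "T \<omega> x2 = D a - ?w *\<^sub>C G (G a)"
    by (simp add: x2_def T_diff x x1)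
  have y_eq: "y = y2 - ?w *\<^sub>C x1"
    by (simp add: y y2_def x2_def complex_vector.scale_right_diff_distrib)
  have "C * (\<gamma> * norm g) \<ge> C * norm (G g)"
    using G_le[of g] C by (intro mult_left_mono) auto
  then have x1_le: "norm x1 \<le> C * (\<gamma> * norm g)"
    using below[of x1] x1 by simp
  have Gx1_le: "\<bar>\<omega>\<bar> * norm (G x1) \<le> 2 * (C * (\<gamma> * norm g))"
  proof -
    have "1 * (\<gamma> * norm g) \<le> C * (\<gamma> * norm g)"
      using C \<gamma> by (intro mult_right_mono) auto
    then have Gg: "norm (G g) \<le> C * (\<gamma> * norm g)"
      using G_le[of g] by simp
    have "(\<bar>\<omega>\<bar> * norm (G x1))\<^sup>2 = \<omega>\<^sup>2 * (norm (G x1))\<^sup>2"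
      by (simp add: power_mult_distrib)
    also have "\<dots> \<le> (norm x1)\<^sup>2 + norm x1 * norm (G g)"
      using energy_le[of \<omega> x1] x1 by simp
    also have "\<dots> \<le> (C * (\<gamma> * norm g))\<^sup>2 + C * (\<gamma> * norm g) * (C * (\<gamma> * norm g))"
      by (intro add_mono power_mono mult_mono) (use x1_le Gg C \<gamma> in auto)
    also have "\<dots> \<le> (2 * (C * (\<gamma> * norm g)))\<^sup>2"
    proof -
      have "P\<^sup>2 + P * P \<le> (2 * P)\<^sup>2" for P :: real
        by (simp add: power2_eq_square)
      then show ?thesis .
    qed
    finally show ?thesis
      by (rule power2_le_imp_le) (use C \<gamma> in auto)
  qed
  have xy2_le: "norm x2 \<le> C * s * norm a" "norm y2 \<le> C * s * norm a"
  proof -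
    have Ca: "norm a \<le> C * norm a"
      using mult_right_mono[OF C, of "norm a"] by simp
    have "norm x2 \<le> C * s * norm a \<and> norm y2 \<le> C * s * norm a"
    proof (cases "\<bar>\<omega>\<bar> \<le> 1")
      case True
      have "norm (T \<omega> x2) \<le> norm (D a) + \<bar>\<omega>\<bar> * norm (G (G a))"
        unfolding Tx2 by (rule order_trans[OF norm_triangle_ineq4]) (simp add: norm_mult)
      also have "\<dots> \<le> b * norm a + 1 * (1 / lam 1 * norm a)"
        using True D_bound norm_G_G_le by (intro add_mono mult_mono) auto
      finally have "C * norm (T \<omega> x2) \<le> C * ((b + 1 / lam 1) * norm a)"
        using C by (intro mult_left_mono) (auto simp: algebra_simps)
      then have x2: "norm x2 \<le> C * ((b + 1 / lam 1) * norm a)"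
        using below[of x2] by linarith
      have "norm y2 \<le> norm a + \<bar>\<omega>\<bar> * norm x2"
        unfolding y2_def by (rule order_trans[OF norm_triangle_ineq4]) (simp add: norm_mult)
      also have "\<bar>\<omega>\<bar> * norm x2 \<le> 1 * norm x2"
        using True by (intro mult_right_mono) auto
      finally have y2: "norm y2 \<le> C * norm a + C * ((b + 1 / lam 1) * norm a)"
        using x2 Ca by linarith
      have "C * s * norm a = 2 * (C * norm a) + C * ((b + 1 / lam 1) * norm a)"
        by (simp add: s_def algebra_simps)
      moreover have "C * norm a \<ge> 0"
        using C by simp
      ultimately show ?thesis
        using x2 y2 by linarith
    next
      case False
      have "T \<omega> y2 = - a"
        unfolding y2_def T_diff T_scaleC Tx2
        using T_scaleC[of \<omega> "-1" a]
        by (simp add: T_def i_times_real_square complex_vector.scale_right_diff_distrib scaleC_scaleC scaleC_of_real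
            del: of_real_power mult.assoc)
      then have y2: "norm y2 \<le> C * norm a"
        using below[of y2] by simp
      have "norm x2 \<le> \<bar>\<omega>\<bar> * norm x2"
        using False mult_right_mono[of 1 "\<bar>\<omega>\<bar>" "norm x2"] by simp
      also have "\<dots> = norm (- a - y2)"
        by (simp add: y2_def norm_mult)
      also have "\<dots> \<le> norm a + norm y2"
        using norm_triangle_ineq4[of "- a" y2] by simp
      finally have x2: "norm x2 \<le> 2 * (C * norm a)"
        using y2 Ca by linarith
      have "C * s * norm a = 2 * (C * norm a) + C * ((b + 1 / lam 1) * norm a)"
        by (simp add: s_def algebra_simps)
      moreover have "C * ((b + 1 / lam 1) * norm a) \<ge> 0" "C * norm a \<ge> 0"
        using C b_nonneg \<gamma>(2) by auto
      ultimately show ?thesis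
        using x2 y2 by linarith
    qed
    then show "norm x2 \<le> C * s * norm a" "norm y2 \<le> C * s * norm a"
      by auto
  qed
  define n where "n = norm_wave L (G a, g)"
  have an: "norm a \<le> n" and gn: "norm g \<le> n"
    by (auto simp: n_def norm_wave_G intro: real_le_rsqrt)
  have "s \<ge> 0"
    using b_nonneg \<gamma>(2) by (simp add: s_def)
  have "norm_wave L (G x, G y) \<le> norm x + norm (G y)"
    unfolding norm_wave_G by (rule sqrt_sum_squares_le_sum) auto
  also have "norm x \<le> norm x1 + norm x2"
    using norm_triangle_ineq[of x1 x2] by (simp add: x2_def)
  also have "norm (G y) \<le> norm (G y2) + \<bar>\<omega>\<bar> * norm (G x1)"
    unfolding y_eq G_diff G_scaleC by (rule order_trans[OF norm_triangle_ineq4]) (simp add: norm_mult)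
  also have "norm (G y2) \<le> \<gamma> * (C * s * norm a)"
    using G_le[of y2] xy2_le(2) \<gamma>(1) by (meson mult_left_mono order_trans)
  also have "norm x1 + norm x2 + (\<gamma> * (C * s * norm a) + \<bar>\<omega>\<bar> * norm (G x1))
      \<le> C * (\<gamma> * norm g) + C * s * norm a + (\<gamma> * (C * s * norm a) + 2 * (C * (\<gamma> * norm g)))"
    using x1_le xy2_le(1) Gx1_le by linarith
  also have "\<dots> \<le> C * (\<gamma> * n) + C * s * n + (\<gamma> * (C * s * n) + 2 * (C * (\<gamma> * n)))"
    using C \<gamma>(1) \<open>s \<ge> 0\<close> an gn by (intro add_mono mult_left_mono) auto
  also have "\<dots> = transfer_const * C * n"
    by (simp add: transfer_const_def s_def \<gamma>_def algebra_simps)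
  finally show ?thesis
    unfolding n_def by simp
qed

text \<open>The lower bound for \<open>T (- \<omega>)\<close>, the adjoint of \<open>T \<omega>\<close>, provides surjectivity.\<close>

theorem resolvent_bound:
  assumes C: "C \<ge> 1" and below: "\<And>x. norm x \<le> C * norm (T \<omega> x)"
    and below': "\<And>x. norm x \<le> C' * norm (T (- \<omega>) x)"
  shows "\<i> * complex_of_real \<omega> \<in> rho_wave L B"
    and "norm_resolvent_wave L B (\<i> * complex_of_real \<omega>) \<le> transfer_const * C"
proof -
  let ?w = "\<i> * complex_of_real \<omega>"
  let ?R = "resolvent (wave_op L B) ?w"
  have surj: "\<exists>x. T \<omega> x = h" for h
    by (rule T_surj[OF below below'])
  have inj: "x = x'" if "T \<omega> x = T \<omega> x'" for x x'
    using below[of "x - x'"] that by (simp add: T_diff)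
  have space: "V \<in> wave_space L \<longleftrightarrow> (\<exists>a g. V = (G a, g))" for V
    by (cases V) (auto simp: wave_space_def H1_eq)
  have bij: "bij_betw (shifted \<omega>) (dom (wave_op L B)) (wave_space L)"
    unfolding bij_betw_def
  proof (intro conjI inj_onI)
    fix U U' assume U: "U \<in> dom (wave_op L B)" "U' \<in> dom (wave_op L B)" "shifted \<omega> U = shifted \<omega> U'"
    then obtain a g where "shifted \<omega> U = (G a, g)"
      using shifted_range by blast
    then have sol: "\<exists>x. V = (G x, G (- a - ?w *\<^sub>C x)) \<and>
        T \<omega> x = G g + D a - ?w *\<^sub>C G (G a)" if "V \<in> {U, U'}" for V
      using that U shifted_eq_iff[of V \<omega> a g] by auto
    obtain x x' where "U = (G x, G (- a - ?w *\<^sub>C x))" "U' = (G x', G (- a - ?w *\<^sub>C x'))"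
      and "T \<omega> x = T \<omega> x'"
      using sol[of U] sol[of U'] by auto
    then show "U = U'"
      using inj by blast
  next
    show "shifted \<omega> ` dom (wave_op L B) = wave_space L"
    proof (intro equalityI subsetI)
      fix V assume "V \<in> shifted \<omega> ` dom (wave_op L B)"
      then show "V \<in> wave_space L"
        unfolding space using shifted_range by blast
    next
      fix V assume "V \<in> wave_space L"
      then obtain a g where V: "V = (G a, g)"
        by (auto simp: space)
      then show "V \<in> shifted \<omega> ` dom (wave_op L B)"
        using surj[of "G g + D a - ?w *\<^sub>C G (G a)"] shifted_eq_iff[of _ \<omega> a g]
        by (metis image_eqI)
    qed
  qed
  have R: "norm_wave L (?R V) \<le> transfer_const * C * norm_wave L V" if V: "V \<in> wave_space L" for V
  proof -
    obtain a g where ag: "V = (G a, g)"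
      using V by (auto simp: space)
    have R_def: "?R = inv_into (dom (wave_op L B)) (shifted \<omega>)"
      by (simp add: resolvent_def shifted_def[abs_def])
    have "V \<in> shifted \<omega> ` dom (wave_op L B)"
      using V bij by (simp add: bij_betw_def)
    then have "?R V \<in> dom (wave_op L B)" "shifted \<omega> (?R V) = (G a, g)"
      unfolding R_def ag[symmetric] by (rule inv_into_into, rule f_inv_into_f)
    then obtain x where "?R V = (G x, G (- a - ?w *\<^sub>C x))"
      "T \<omega> x = G g + D a - ?w *\<^sub>C G (G a)"
      using shifted_eq_iff[of "?R V" \<omega> a g] by blast
    then show ?thesis
      using resolvent_estimate[OF C below surj] by (simp add: ag)
  qed
  show "?w \<in> rho_wave L B"
    using bij R unfolding resolvent_set_def bounded_on_def shifted_def[abs_def] by blast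
  have "(G 0, 0) \<in> wave_space L"
    by (auto simp: space)
  then show "norm_resolvent_wave L B ?w \<le> transfer_const * C"
    using C transfer_const_pos R by (intro opnorm_le) (auto simp: norm_wave_def)
qed

end


section \<open>The resolvent between consecutive eigenvalues\<close>

context damped_wave_operator
begin

text \<open>On the eigenspace of \<open>\<lambda>\<^sub>k\<close> the operator \<open>G\<close> is the scalar \<open>1 / \<surd>\<lambda>\<^sub>k\<close>, so the lower
  bound for \<open>B\<close> on unit eigenvectors becomes a coercivity estimate for \<open>D\<close>.\<close>

lemma coercive_on_eigenspace:
  assumes k: "k \<ge> 1" and \<beta>: "\<beta> > 0"
    and least: "\<And>\<phi>. \<phi> \<in> eigenspace L (complex_of_real (lam k)) \<Longrightarrow> norm \<phi> = 1 \<Longrightarrow>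
      1 / \<beta> \<le> Re (B \<phi> \<phi>)"
    and e: "e \<in> eigenspace L (complex_of_real (lam k))"
  shows "(norm e)\<^sup>2 \<le> \<beta> * lam k * inner e (D e)"
proof (cases "e = 0")
  case True
  then show ?thesis
    using \<beta> lam_nonneg[of k] D_nonneg[of e] by simp
next
  case False
  define c where "c = complex_of_real (sqrt (lam k) / norm e)"
  define \<phi> where "\<phi> = (1 / complex_of_real (norm e)) *\<^sub>C e"
  have \<phi>: "\<phi> \<in> eigenspace L (complex_of_real (lam k))"
    unfolding \<phi>_def by (rule complex_vector.subspace_scale[OF csubspace_E e])
  have "norm \<phi> = 1"
    using False by (simp add: \<phi>_def norm_divide)
  have "proj j \<phi> = proj j (G (c *\<^sub>C e))" for j
  proof (cases "j = k")
    case True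
    have "(1 / sqrt (lam k)) *\<^sub>R c *\<^sub>C e = \<phi>"
      using lam_pos[OF k] by (simp add: \<phi>_def c_def scaleC_scaleC flip: scaleC_of_real)
    then show ?thesis
      using True by (simp add: proj_G proj_scaleC proj_same[OF e] proj_same[OF \<phi>])
  next
    case False
    then show ?thesis
      by (simp add: proj_G proj_scaleC proj_other[OF e] proj_other[OF \<phi>])
  qed
  then have "\<phi> = G (c *\<^sub>C e)"
    by (rule proj_ext)
  then have "Re (B \<phi> \<phi>) = (cmod c)\<^sup>2 * inner e (D e)"
    by (simp add: B_G inner_D_scaleC flip: inner_eq_Re_cinner)
  also have "(cmod c)\<^sup>2 = lam k / (norm e)\<^sup>2"
    using lam_nonneg[of k] by (simp add: c_def norm_divide power_divide del: of_real_divide)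
  finally have "1 / \<beta> \<le> lam k / (norm e)\<^sup>2 * inner e (D e)"
    using least[OF \<phi> \<open>norm \<phi> = 1\<close>] by simp
  then show ?thesis
    using \<beta> False by (simp add: field_simps)
qed

theorem resolvent_bound_between_eigenvalues:
  assumes k: "k \<ge> 1" and below: "lam (k - 1) < \<omega>\<^sup>2" and above: "\<omega>\<^sup>2 < lam (k + 1)"
    and \<beta>: "\<beta> k > 0"
    and least: "\<And>\<phi>. \<phi> \<in> eigenspace L (complex_of_real (lam k)) \<Longrightarrow> norm \<phi> = 1 \<Longrightarrow>
      1 / \<beta> k \<le> Re (B \<phi> \<phi>)"
  shows "\<i> * complex_of_real \<omega> \<in> rho_wave L B"
    and "norm_resolvent_wave L B (\<i> * complex_of_real \<omega>)
      \<le> transfer_const * c_bound lam \<beta> b k \<omega>"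
proof -
  define m where "m = \<beta> k * lam k"
  define a where "a = alpha lam (k - 1) \<omega> + alpha lam (k + 1) \<omega>"
  have m: "m \<ge> 0"
    using \<beta> lam_nonneg by (simp add: m_def)
  have c: "c_bound lam \<beta> b k \<omega>
      = (m / \<bar>\<omega>\<bar> + (1 + m) * a\<^sup>2 * (1 + \<bar>\<omega>\<bar>)) * (16 * (1 + b)\<^sup>2)"
    by (simp add: c_bound_def m_def a_def)
  have coercive: "(norm e)\<^sup>2 \<le> m * inner e (D e)"
    if "e \<in> eigenspace L (complex_of_real (lam k))" for e
    unfolding m_def using coercive_on_eigenspace[OF k \<beta> least that] .
  have "norm x \<le> c_bound lam \<beta> b k \<omega> * norm (T \<omega> x)" for x
    using T_bounded_below[OF k below above m coercive] by (simp add: c a_def)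
  moreover have "norm x \<le> c_bound lam \<beta> b k \<omega> * norm (T (- \<omega>) x)" for x
    using T_bounded_below[of k "- \<omega>", OF k _ _ m coercive] below above
    by (simp add: c a_def alpha_def)
  moreover have "c_bound lam \<beta> b k \<omega> \<ge> 1"
  proof -
    have "a \<ge> 1"
      unfolding a_def
      using alpha_above_ge_1[OF k below above] alpha_below_nonneg[OF k below above] by linarith
    then have "1 * 1 * 1 \<le> (1 + m) * a\<^sup>2 * (1 + \<bar>\<omega>\<bar>)"
      using m by (intro mult_mono) auto
    moreover have "1 \<le> (1 + b)\<^sup>2"
      using b_nonneg by simp
    ultimately have "1 * 1 \<le> (m / \<bar>\<omega>\<bar> + (1 + m) * a\<^sup>2 * (1 + \<bar>\<omega>\<bar>)) * (16 * (1 + b)\<^sup>2)"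
      using m add_increasing[of "m / \<bar>\<omega>\<bar>" 1] by (intro mult_mono) auto
    then show ?thesis
      by (simp add: c)
  qed
  ultimately show "\<i> * complex_of_real \<omega> \<in> rho_wave L B"
    and "norm_resolvent_wave L B (\<i> * complex_of_real \<omega>)
      \<le> transfer_const * c_bound lam \<beta> b k \<omega>"
    by (metis resolvent_bound(1), metis resolvent_bound(2))
qed

lemma zero_in_resolvent_set: "0 \<in> rho_wave L B"
  using resolvent_bound(1)[of 1 0 1] by (simp add: T_def)

end

context discrete_spectrum
begin

lemma norm_H1_nonneg: "norm_H1 L x \<ge> 0"
  by (simp add: norm_H1_def)

text \<open>Conjugating \<open>B\<close> with \<open>G = L\<^sup>-\<^sup>1\<^sup>/\<^sup>2\<close>, an isometry from \<open>H\<^sub>0\<close> onto \<open>H\<^sub>1\<close>, turns it into a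
  bounded operator on \<open>H\<^sub>0\<close>.\<close>

lemma damping_representation:
  assumes B_linear: "linear_H1_Hm1 L B"
    and B_bounded: "bounded_on (H1 L) (norm_H1 L) (norm_Hm1 L) B"
    and B_symmetric: "\<forall>\<phi>\<in>H1 L. \<forall>\<psi>\<in>H1 L. B \<phi> \<psi> = cnj (B \<psi> \<phi>)"
    and B_nonneg: "\<forall>\<phi>\<in>H1 L. B \<phi> \<phi> \<in> \<real>\<^sub>\<ge>\<^sub>0"
  shows "\<exists>D. damped_wave_operator L lam D (opnorm (H1 L) (norm_H1 L) (norm_Hm1 L) B) B"
proof -
  define b where "b = opnorm (H1 L) (norm_H1 L) (norm_Hm1 L) B"
  have Hm1: "B (G x) \<in> Hm1 L" for x
    using B_linear by (simp add: linear_H1_Hm1_def H1_eq)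
  have bounded: "bounded_on (H1 L) (norm_H1 L) cmod (B (G x))" for x
    using Hm1[of x] by (simp add: Hm1_def)
  have "norm_Hm1 L (B (G 0)) \<ge> 0"
    unfolding norm_Hm1_def
    by (rule opnorm_nonneg[OF bounded norm_H1_nonneg, of "G 0"]) (simp_all add: H1_eq)
  then have b: "b \<ge> 0"
    unfolding b_def by (intro opnorm_nonneg[OF B_bounded norm_H1_nonneg, of "G 0"]) (simp_all add: H1_eq)
  have B_le: "cmod (B (G x) (G y)) \<le> b * norm x * norm y" for x y
  proof -
    have "cmod (B (G x) (G y)) \<le> norm_Hm1 L (B (G x)) * norm y"
      using le_opnorm[OF bounded norm_H1_nonneg, of "G y" x] by (simp add: H1_eq norm_Hm1_def)
    also have "\<dots> \<le> b * norm x * norm y"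
      using le_opnorm[OF B_bounded norm_H1_nonneg, of "G x"]
      by (intro mult_right_mono) (simp_all add: H1_eq b_def)
    finally show ?thesis .
  qed
  have add_right: "B (G x) (G (y + z)) = B (G x) (G y) + B (G x) (G z)" for x y z
    using Hm1[of x] by (simp add: Hm1_def H1_eq G_add)
  have scale_right: "B (G x) (G (c *\<^sub>C y)) = cnj c * B (G x) (G y)" for x y c
    using Hm1[of x] by (simp add: Hm1_def H1_eq G_scaleC)
  have "\<exists>w. \<forall>y. cinner y w = B (G x) (G y)" for x
  proof -
    have "bounded_linear (\<lambda>y. Re (B (G x) (G y)))"
    proof
      show "Re (B (G x) (G (r *\<^sub>R y))) = r *\<^sub>R Re (B (G x) (G y))" for r y
        using scale_right[of x "of_real r" y] by (simp add: scaleC_of_real)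
      show "\<exists>K. \<forall>y. norm (Re (B (G x) (G y))) \<le> norm y * K"
      proof (intro exI allI)
        show "norm (Re (B (G x) (G y))) \<le> norm y * (b * norm x)" for y
          using abs_Re_le_cmod[of "B (G x) (G y)"] B_le[of x y] by (simp add: mult_ac)
      qed
    qed (simp add: add_right)
    then obtain w where w: "\<And>y. Re (B (G x) (G y)) = inner y w"
      using riesz_representation by metis
    have "cinner y w = B (G x) (G y)" for y
      by (rule cinner_eq_of_inner_eq) (simp_all add: w scale_right)
    then show ?thesis
      by blast
  qed
  then obtain D where D: "\<And>x y. cinner y (D x) = B (G x) (G y)"
    by metis
  have "damped_wave_operator L lam D b B"
  proof unfold_locales
    fix x y c
    show "D (x + y) = D x + D y"
      using B_linear by (intro cinner_eqI) (simp add: D cinner_linear G_add linear_H1_Hm1_def H1_eq)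
    show "D (c *\<^sub>C x) = c *\<^sub>C D x"
      using B_linear by (intro cinner_eqI) (simp add: D cinner_linear G_scaleC linear_H1_Hm1_def H1_eq)
    show "cinner (D x) y = cinner x (D y)"
    proof -
      have "cinner (D x) y = cnj (B (G x) (G y))"
        unfolding D[symmetric] by (rule cinner_commute)
      also have "\<dots> = B (G y) (G x)"
        using B_symmetric unfolding H1_eq by (metis rangeI)
      finally show ?thesis
        by (simp add: D)
    qed
    show "inner x (D x) \<ge> 0"
      using B_nonneg by (simp add: inner_eq_Re_cinner D H1_eq complex_nonneg_Reals_iff)
    show "norm (D x) \<le> b * norm x"
    proof (cases "D x = 0")
      case False
      have "(norm (D x))\<^sup>2 = Re (B (G x) (G (D x)))"
        by (simp add: cinner_self flip: D)
      also have "\<dots> \<le> b * norm x * norm (D x)"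
        using complex_Re_le_cmod B_le order_trans by blast
      finally show ?thesis
        using False by (simp add: power2_eq_square)
    qed (simp add: b)
    show "B (G x) \<phi> = 0" if "\<phi> \<notin> H1 L" for \<phi>
      using Hm1[of x] that by (simp add: Hm1_def)
  qed (simp_all add: b D)
  then show ?thesis
    unfolding b_def by blast
qed

text \<open>If \<open>\<lambda>\<^sub>n\<close> is the first eigenvalue above \<open>\<omega>\<^sup>2\<close>, then \<open>k = n - 1\<close> works, even when
  \<open>\<omega>\<^sup>2 = \<lambda>\<^sub>n\<^sub>-\<^sub>1\<close>; for \<open>n = 1\<close> one takes \<open>k = 1\<close>.\<close>

lemma frequency_between_eigenvalues:
  assumes "filterlim lam at_top sequentially" and "\<omega> \<noteq> 0"
  shows "\<exists>k\<ge>1. lam (k - 1) < \<omega>\<^sup>2 \<and> \<omega>\<^sup>2 < lam (k + 1)"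
proof -
  have ex: "\<exists>n. \<omega>\<^sup>2 < lam n"
    using assms(1) unfolding filterlim_at_top_dense
    by (meson eventually_sequentially order_refl)
  define n where "n = (LEAST n. \<omega>\<^sup>2 < lam n)"
  have n: "\<omega>\<^sup>2 < lam n" "\<And>i. i < n \<Longrightarrow> lam i \<le> \<omega>\<^sup>2"
    unfolding n_def using LeastI_ex[OF ex] not_less_Least not_less by blast+
  have "0 < \<omega>\<^sup>2"
    using \<open>\<omega> \<noteq> 0\<close> by simp
  then have "n \<noteq> 0"
    using n(1) lam_0 by (metis less_asym)
  show ?thesis
  proof (cases "n = 1")
    case True
    then show ?thesis
      using n(1) \<open>0 < \<omega>\<^sup>2\<close> lam_0 strict_monoD[OF lam_mono, of 1 2]
      by (intro exI[of _ 1]) (auto simp: numeral_2_eq_2)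
  next
    case False
    then have "lam (n - 2) < lam (n - 1)"
      using \<open>n \<noteq> 0\<close> by (intro strict_monoD[OF lam_mono]) auto
    then have "lam (n - 1 - 1) < \<omega>\<^sup>2"
      using n(2)[of "n - 1"] \<open>n \<noteq> 0\<close> by (simp add: numeral_2_eq_2)
    then show ?thesis
      using False \<open>n \<noteq> 0\<close> n(1) by (intro exI[of _ "n - 1"]) auto
  qed
qed

end

theorem proposition2p8:
  fixes L :: "'h::{complex_inner, complete_space} \<rightharpoonup> 'h"
    and B :: "'h \<Rightarrow> 'h \<Rightarrow> complex"
    and lam \<beta> :: "nat \<Rightarrow> real"
  assumes separable: "separable_space (euclidean :: 'h topology)"
    and infinite_dim: "\<not> (\<exists>F :: 'h set. finite F \<and> cspan F = UNIV)"
    and L_selfadjoint: "selfadjoint_op L"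
    and L_positive: "positive_op L"
    and L_unbounded: "unbounded_op L"
    and L_compact_resolvent: "compact_resolvent L"
    and lam_0: "lam 0 = 0"
    and lam_mono: "strict_mono lam"
    and lam_lim: "filterlim lam at_top sequentially"
    and lam_eigenvalues: "eigenvalues L = {complex_of_real (lam k) | k. k \<ge> 1}"
    and lam_mult: "\<forall>k\<ge>1. \<exists>F. finite F \<and> eigenspace L (lam k) \<subseteq> cspan F"
    and B_linear: "linear_H1_Hm1 L B"
    and B_bounded: "bounded_on (H1 L) (norm_H1 L) (norm_Hm1 L) B"
    and B_symmetric: "\<forall>\<phi>\<in>H1 L. \<forall>\<psi>\<in>H1 L. B \<phi> \<psi> = cnj (B \<psi> \<phi>)"
    and B_nonneg: "\<forall>\<phi>\<in>H1 L. B \<phi> \<phi> \<in> \<real>\<^sub>\<ge>\<^sub>0"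
    and beta_attained:
      "\<forall>k\<ge>1. \<exists>\<phi>\<in>eigenspace L (lam k). norm \<phi> = 1 \<and> 1 / \<beta> k = Re (B \<phi> \<phi>)"
    and beta_least:
      "\<forall>k\<ge>1. \<forall>\<phi>\<in>eigenspace L (lam k). norm \<phi> = 1 \<longrightarrow> 1 / \<beta> k \<le> Re (B \<phi> \<phi>)"
    and beta_pos: "\<forall>k\<ge>1. 1 / \<beta> k > 0"
  shows "\<exists>c>0. \<forall>\<omega>::real.
    \<i> * complex_of_real \<omega> \<in> rho_wave L B \<and>
    (\<forall>k\<ge>1. lam (k - 1) < \<omega>\<^sup>2 \<and> \<omega>\<^sup>2 < lam (k + 1) \<longrightarrow>
      norm_resolvent_wave L B (\<i> * complex_of_real \<omega>)
        \<le> c * c_bound lam \<beta> (opnorm (H1 L) (norm_H1 L) (norm_Hm1 L) B) k \<omega>)"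
proof -
  interpret discrete_spectrum L lam
    by unfold_locales
      (fact L_selfadjoint L_positive L_compact_resolvent lam_0 lam_mono lam_eigenvalues)+
  obtain D where
    "damped_wave_operator L lam D (opnorm (H1 L) (norm_H1 L) (norm_Hm1 L) B) B"
    using damping_representation[OF B_linear B_bounded B_symmetric B_nonneg] by blast
  then interpret damped_wave_operator L lam D "opnorm (H1 L) (norm_H1 L) (norm_Hm1 L) B" B .
  have \<beta>: "\<beta> k > 0" if "k \<ge> 1" for k
    using beta_pos that by simp
  show ?thesis
  proof (intro exI conjI allI impI)
    show "transfer_const > 0"
      by (rule transfer_const_pos)
    fix \<omega> :: real
    show "\<i> * complex_of_real \<omega> \<in> rho_wave L B"
    proof (cases "\<omega> = 0")
      case True
      then show ?thesis
        using zero_in_resolvent_set by simp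
    next
      case False
      then obtain k where "k \<ge> 1" "lam (k - 1) < \<omega>\<^sup>2" "\<omega>\<^sup>2 < lam (k + 1)"
        using frequency_between_eigenvalues[OF lam_lim] by blast
      then show ?thesis
        using resolvent_bound_between_eigenvalues(1)[of k \<omega> \<beta>] \<beta> beta_least by blast
    qed
    fix k :: nat
    assume "1 \<le> k" and "lam (k - 1) < \<omega>\<^sup>2 \<and> \<omega>\<^sup>2 < lam (k + 1)"
    then show "norm_resolvent_wave L B (\<i> * complex_of_real \<omega>)
        \<le> transfer_const * c_bound lam \<beta> (opnorm (H1 L) (norm_H1 L) (norm_Hm1 L) B) k \<omega>"
      using resolvent_bound_between_eigenvalues(2)[of k \<omega> \<beta>] \<beta> beta_least by blast
  qed
qed

end
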